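(* Let $G$ be a profinite group with finite virtual cohomological dimension, and let $\{M_i\}_{i\ge 0}$ be a tower $M_0 \leftarrow M_1 \leftarrow M_2 \leftarrow \cdots$ of discrete $G$-modules and $G$-equivariant homomorphisms. Regard $\lim_i M_i$ as a topological $G$-module with the inverse limit topology. Then for all $s\ge 0$ $$H^s_{\mathrm{cts}}(G;\lim_i M_i) \cong H^s[\mathcal{C}^\ast(G;\{M_i\})],$$ where $H^s_{\mathrm{cts}}$ is continuous cochain cohomology and $\mathcal{C}^\ast(G;\{M_i\})=\lim_i(\Gamma_G^\ast M_i)^G$ is the pro-discrete cochain complex.
   Context: Finite virtual cohomological dimension: there are an open subgroup $H\le G$ and an integer $m\ge 0$ such that $H^s_c(H;M)=0$ for all discrete $H$-modules $M$ and all $s\ge m$, where $H^s_c(H;-)$ denotes the right derived functors of $H$-fixed points on discrete $H$-modules. Topological $G$-module: an abelian Hausdorff topological group $M$ with a continuous $G$-action by group automorphisms. A discrete $G$-module is a topological $G$-module with the discrete topology. Continuous cochain cohomology: for a topological $G$-module $M$, let $X^n(G;M)=\mathrm{Map}_c(G^{n+1},M)$ ($n\ge0$) be the abelian group of continuous maps, with $G$-action $(g\cdot f)(g_1,\dots,g_{n+1})=g\cdot f(g^{-1}g_1,\dots,g^{-1}g_{n+1})$, and with the usual homogeneous differential $(\partial f)(g_1,\dots,g_{n+2})=\sum_{j=1}^{n+2}(-1)^{j-1}f(g_1,\dots,\widehat{g_j},\dots,g_{n+2})$. Then $H^s_{\mathrm{cts}}(G;M)$ is the $s$-th cohomology of the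 cochain complex of $G$-fixed points $(X^\ast(G;M))^G$ (equivalently, of a complex of the form $M\to \mathrm{Map}_c(G,M)\to\mathrm{Map}_c(G^2,M)\to\cdots$). The functor $\Gamma_G$: for a discrete $G$-module $M$, $\Gamma_G(M)=\mathrm{Map}_c(G,M)$ is the abelian group of continuous maps $G\to M$ with $G$-action $(g\cdot f)(g')=f(g'g)$; it is a discrete $G$-module. The functor $\Gamma_G$ is a triple (monad) on discrete $G$-modules, with unit $\eta\colon M\to\Gamma_G M$, $x\mapsto(g\mapsto g\cdot x)$, and multiplication $\mu\colon\Gamma_G\Gamma_G M\to\Gamma_G M$, $F\mapsto(g\mapsto F(g)(1))$. It yields a cosimplicial discrete $G$-module $\Gamma_G^\bullet M$ whose group of $m$-cosimplices is $\Gamma_G^{m+1}M$ ($m\ge0$), with cofaces $d^j=\Gamma_G^{j}\,\eta\,\Gamma_G^{m+1-j}\colon\Gamma_G^{m+1}M\to\Gamma_G^{m+2}M$, $0\le j\le m+1$, and codegeneracies induced similarly by $\mu$. $\Gamma_G^\ast M$ denotes the associated cochain complex, with differential $\sum_j(-1)^jd^j$. Pro-discrete cochain complex: $\mathcal{C}^\ast(G;\{M_i\})=\lim_i(\Gamma_G^\ast M_i)^G$, the cochain complex of abelian groups obtained by taking $G$-fixed points degreewise and then the inverse limit over $i$ of abelian groups. *)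

theory Defs
  imports "HOL-Analysis.Function_Topology" "HOL-Analysis.Abstract_Topological_Spaces"
    "HOL-Algebra.Product_Groups" "HOL-Algebra.FiniteProduct"
begin

section \<open>Topological groups and modules\<close>

text \<open>
  Abelian groups are groups in the sense of HOL-Algebra and are therefore written
  multiplicatively.  Maps between carriers are total HOL functions; whenever a set of maps is
  itself the carrier of a group, its elements are taken extensional.
\<close>

record 'g topgroup = "'g monoid" +
  gtop :: "'g topology"

record ('g, 'm) gmod = "'m monoid" +
  act :: "'g \<Rightarrow> 'm \<Rightarrow> 'm"

record ('g, 'm) top_gmod = "('g, 'm) gmod" +
  mtop :: "'m topology"

definition topological_group :: "('a, 'b) monoid_scheme \<Rightarrow> 'a topology \<Rightarrow> bool" where
  "topological_group A T \<longleftrightarrow>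
     group A \<and> topspace T = carrier A \<and>
     continuous_map (prod_topology T T) T (\<lambda>(x, y). x \<otimes>\<^bsub>A\<^esub> y) \<and>
     continuous_map T T (\<lambda>x. inv\<^bsub>A\<^esub> x)"

definition profinite_group :: "'g topgroup \<Rightarrow> bool" where
  "profinite_group G \<longleftrightarrow>
     topological_group G (gtop G) \<and> compact_space (gtop G) \<and> Hausdorff_space (gtop G) \<and>
     (\<forall>S. connectedin (gtop G) S \<longrightarrow> (\<exists>a. S \<subseteq> {a}))"

definition restrict_group :: "'g topgroup \<Rightarrow> 'g set \<Rightarrow> 'g topgroup" where
  "restrict_group G H = G\<lparr>carrier := H, gtop := subtopology (gtop G) H\<rparr>"

definition topological_module :: "'g topgroup \<Rightarrow> ('g, 'm) top_gmod \<Rightarrow> bool" where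
  "topological_module G M \<longleftrightarrow>
     comm_group M \<and> topological_group M (mtop M) \<and> Hausdorff_space (mtop M) \<and>
     (\<forall>g\<in>carrier G. act M g \<in> hom M M) \<and>
     (\<forall>x\<in>carrier M. act M \<one>\<^bsub>G\<^esub> x = x) \<and>
     (\<forall>g\<in>carrier G. \<forall>h\<in>carrier G. \<forall>x\<in>carrier M.
        act M (g \<otimes>\<^bsub>G\<^esub> h) x = act M g (act M h x)) \<and>
     continuous_map (prod_topology (gtop G) (mtop M)) (mtop M) (\<lambda>(g, x). act M g x)"

definition discrete_module :: "'g topgroup \<Rightarrow> ('g, 'm) top_gmod \<Rightarrow> bool" where
  "discrete_module G M \<longleftrightarrow>
     topological_module G M \<and> mtop M = discrete_topology (carrier M)"

definition gmod_hom ::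
    "'g topgroup \<Rightarrow> ('g, 'm) top_gmod \<Rightarrow> ('g, 'n) top_gmod \<Rightarrow> ('m \<Rightarrow> 'n) set" where
  "gmod_hom G M N =
     {f \<in> hom M N. \<forall>g\<in>carrier G. \<forall>x\<in>carrier M. f (act M g x) = act N g (f x)}"

definition fixed_points ::
    "'g topgroup \<Rightarrow> ('g, 'm, 'z) gmod_scheme \<Rightarrow> ('g, 'm, 'z) gmod_scheme" where
  "fixed_points G M =
     M\<lparr>carrier := {x \<in> carrier M. \<forall>g\<in>carrier G. act M g x = x}\<rparr>"


section \<open>Cohomology of a cochain complex of abelian groups\<close>

text \<open>The terms of the complex are indexed by the natural numbers and are zero in negative degrees.\<close>

definition coboundaries ::
    "(nat \<Rightarrow> ('a, 'z) monoid_scheme) \<Rightarrow> (nat \<Rightarrow> 'a \<Rightarrow> 'a) \<Rightarrow> nat \<Rightarrow> 'a set" where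
  "coboundaries C d s = (case s of 0 \<Rightarrow> {\<one>\<^bsub>C 0\<^esub>} | Suc r \<Rightarrow> d r ` carrier (C r))"

definition cochain_cohomology ::
    "(nat \<Rightarrow> ('a, 'z) monoid_scheme) \<Rightarrow> (nat \<Rightarrow> 'a \<Rightarrow> 'a) \<Rightarrow> nat \<Rightarrow> 'a set monoid" where
  "cochain_cohomology C d s =
     (C s)\<lparr>carrier := kernel (C s) (C (Suc s)) (d s)\<rparr> Mod coboundaries C d s"


section \<open>Derived functors of fixed points and virtual cohomological dimension\<close>

text \<open>
  Everything here takes place in the category of discrete modules whose carriers are subsets of
  one HOL type \<open>'u\<close>.
\<close>

definition injective_module :: "'g topgroup \<Rightarrow> ('g, 'u) top_gmod \<Rightarrow> bool" where
  "injective_module G I \<longleftrightarrow>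
     discrete_module G I \<and>
     (\<forall>(A :: ('g, 'u) top_gmod) (B :: ('g, 'u) top_gmod). \<forall>i f.
        discrete_module G A \<and> discrete_module G B \<and>
        i \<in> gmod_hom G A B \<and> inj_on i (carrier A) \<and> f \<in> gmod_hom G A I \<longrightarrow>
        (\<exists>h \<in> gmod_hom G B I. \<forall>a\<in>carrier A. h (i a) = f a))"

text \<open>\<open>0 \<rightarrow> M \<rightarrow> I 0 \<rightarrow> I 1 \<rightarrow> \<dots>\<close> with augmentation \<open>e\<close> and differentials \<open>d\<close>.\<close>

definition injective_resolution ::
    "'g topgroup \<Rightarrow> ('g, 'u) top_gmod \<Rightarrow> ('u \<Rightarrow> 'u) \<Rightarrow>
     (nat \<Rightarrow> ('g, 'u) top_gmod) \<Rightarrow> (nat \<Rightarrow> 'u \<Rightarrow> 'u) \<Rightarrow> bool" where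
  "injective_resolution G M e I d \<longleftrightarrow>
     (\<forall>n. injective_module G (I n)) \<and>
     e \<in> gmod_hom G M (I 0) \<and> inj_on e (carrier M) \<and>
     (\<forall>n. d n \<in> gmod_hom G (I n) (I (Suc n))) \<and>
     kernel (I 0) (I 1) (d 0) = e ` carrier M \<and>
     (\<forall>n. kernel (I (Suc n)) (I (Suc (Suc n))) (d (Suc n)) = d n ` carrier (I n))"

text \<open>
  The right derived functors of fixed points, evaluated on \<open>M\<close>.  Up to isomorphism the result is
  independent of the chosen resolution; that there is one requires \<open>'u\<close> to be large enough
  (see \<open>module_universe\<close>).
\<close>

definition derived_fixed_points ::
    "'g topgroup \<Rightarrow> ('g, 'u) top_gmod \<Rightarrow> nat \<Rightarrow> 'u set monoid" where
  "derived_fixed_points G M s =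
     (case (SOME (I, d). \<exists>e. injective_resolution G M e I d) of
        (I, d) \<Rightarrow> cochain_cohomology (\<lambda>n. fixed_points G (I n)) d s)"

definition finite_vcd :: "'u itself \<Rightarrow> 'g topgroup \<Rightarrow> bool" where
  "finite_vcd _ G \<longleftrightarrow>
     (\<exists>H m. subgroup H G \<and> openin (gtop G) H \<and>
        (\<forall>M :: ('g, 'u) top_gmod. discrete_module (restrict_group G H) M \<longrightarrow>
           (\<forall>s\<ge>m. trivial_group (derived_fixed_points (restrict_group G H) M s))))"

text \<open>
  HOL cannot quantify over all types inside a formula, so ``all discrete modules'' has to mean all
  discrete modules on some fixed, sufficiently large type.  The type \<open>'u\<close> below contains copies of
  \<open>'g\<close> and \<open>'m\<close>, is infinite, and is equinumerous with \<open>'g \<Rightarrow> 'u\<close>.  Hence a discrete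
  \<open>H\<close>-module on \<open>'u\<close> embeds in a divisible abelian group \<open>D\<close> on \<open>'u\<close>, and so in the
  injective discrete \<open>H\<close>-module of continuous maps from \<open>H\<close> to \<open>D\<close>, which again fits in \<open>'u\<close>:
  there are enough injectives, and they are injective among all discrete modules.  Since \<open>'u\<close> also
  contains a copy of every finitely generated (hence countable) discrete \<open>H\<close>-module, and derived
  fixed points commute with filtered colimits, finite virtual cohomological dimension over \<open>'u\<close>
  does not differ from the unrestricted notion.
\<close>

type_synonym ('g, 'm) module_universe = "('g + 'm + nat) set"


section \<open>Continuous cochain cohomology\<close>

text \<open>\<open>n + 1\<close>-tuples are extensional functions on \<open>{..n}\<close>; coordinates are numbered from \<open>0\<close>.\<close>

definition tuples :: "'g topgroup \<Rightarrow> nat \<Rightarrow> (nat \<Rightarrow> 'g) set" where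
  "tuples G n = (\<Pi>\<^sub>E i\<in>{..n}. carrier G)"

definition cts_cochains ::
    "'g topgroup \<Rightarrow> ('g, 'm) top_gmod \<Rightarrow> nat \<Rightarrow> ('g, (nat \<Rightarrow> 'g) \<Rightarrow> 'm) gmod" where
  "cts_cochains G M n =
     \<lparr>carrier = {f \<in> extensional (tuples G n).
                   continuous_map (product_topology (\<lambda>i. gtop G) {..n}) (mtop M) f},
      monoid.mult = (\<lambda>f f'. \<lambda>x\<in>tuples G n. f x \<otimes>\<^bsub>M\<^esub> f' x),
      one = (\<lambda>x\<in>tuples G n. \<one>\<^bsub>M\<^esub>),
      act = (\<lambda>g f. \<lambda>x\<in>tuples G n. act M g (f (\<lambda>i\<in>{..n}. inv\<^bsub>G\<^esub> g \<otimes>\<^bsub>G\<^esub> x i)))\<rparr>"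

definition omit :: "nat \<Rightarrow> nat \<Rightarrow> (nat \<Rightarrow> 'g) \<Rightarrow> nat \<Rightarrow> 'g" where
  "omit n j x = (\<lambda>i\<in>{..n}. if i < j then x i else x (Suc i))"

definition cts_diff ::
    "'g topgroup \<Rightarrow> ('g, 'm) top_gmod \<Rightarrow> nat \<Rightarrow> ((nat \<Rightarrow> 'g) \<Rightarrow> 'm) \<Rightarrow> (nat \<Rightarrow> 'g) \<Rightarrow> 'm" where
  "cts_diff G M n f =
     (\<lambda>x\<in>tuples G (Suc n).
        finprod M (\<lambda>j. f (omit n j x) [^]\<^bsub>M\<^esub> ((-1 :: int) ^ j)) {..Suc n})"

definition cts_cohomology ::
    "'g topgroup \<Rightarrow> ('g, 'm) top_gmod \<Rightarrow> nat \<Rightarrow> ((nat \<Rightarrow> 'g) \<Rightarrow> 'm) set monoid" where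
  "cts_cohomology G M s =
     cochain_cohomology (\<lambda>n. fixed_points G (cts_cochains G M n)) (cts_diff G M) s"


section \<open>The functor \<open>\<Gamma>\<close> and its cosimplicial resolution\<close>

text \<open>
  The carriers of the iterates of \<open>\<Gamma>\<close> on \<open>M\<close> have the types \<open>'m\<close>, \<open>'g \<Rightarrow> 'm\<close>,
  \<open>'g \<Rightarrow> 'g \<Rightarrow> 'm\<close>, and so on.  The following datatype is the union of these types, so that
  \<open>\<Gamma>\<close> becomes an endofunctor which can be iterated; its constructors merely mark an element of
  \<open>M\<close> and a map from \<open>G\<close>, respectively.
\<close>

datatype ('g, 'm) iter = Val (un_Val: 'm) | Fn (app: "'g \<Rightarrow> ('g, 'm) iter")

definition lift_module :: "('g, 'm) top_gmod \<Rightarrow> ('g, ('g, 'm) iter) top_gmod" where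
  "lift_module M =
     \<lparr>carrier = Val ` carrier M,
      monoid.mult = (\<lambda>x y. Val (un_Val x \<otimes>\<^bsub>M\<^esub> un_Val y)),
      one = Val \<one>\<^bsub>M\<^esub>,
      act = (\<lambda>g x. Val (act M g (un_Val x))),
      mtop = pullback_topology (Val ` carrier M) un_Val (mtop M)\<rparr>"

definition lift_map :: "('m \<Rightarrow> 'n) \<Rightarrow> ('g, 'm) iter \<Rightarrow> ('g, 'n) iter" where
  "lift_map \<phi> x = Val (\<phi> (un_Val x))"

definition Gamma_carrier :: "'g topgroup \<Rightarrow> ('g, ('g, 'm) iter) top_gmod \<Rightarrow> ('g, 'm) iter set" where
  "Gamma_carrier G M =
     Fn ` {f \<in> extensional (carrier G). continuous_map (gtop G) (mtop M) f}"

definition Gamma ::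
    "'g topgroup \<Rightarrow> ('g, ('g, 'm) iter) top_gmod \<Rightarrow> ('g, ('g, 'm) iter) top_gmod" where
  "Gamma G M =
     \<lparr>carrier = Gamma_carrier G M,
      monoid.mult = (\<lambda>F F'. Fn (\<lambda>g\<in>carrier G. app F g \<otimes>\<^bsub>M\<^esub> app F' g)),
      one = Fn (\<lambda>g\<in>carrier G. \<one>\<^bsub>M\<^esub>),
      act = (\<lambda>h F. Fn (\<lambda>g\<in>carrier G. app F (g \<otimes>\<^bsub>G\<^esub> h))),
      mtop = discrete_topology (Gamma_carrier G M)\<rparr>"

definition Gamma_map ::
    "'g topgroup \<Rightarrow> (('g, 'm) iter \<Rightarrow> ('g, 'n) iter) \<Rightarrow> ('g, 'm) iter \<Rightarrow> ('g, 'n) iter" where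
  "Gamma_map G \<phi> F = Fn (\<lambda>g\<in>carrier G. \<phi> (app F g))"

definition Gamma_unit ::
    "'g topgroup \<Rightarrow> ('g, ('g, 'm) iter) top_gmod \<Rightarrow> ('g, 'm) iter \<Rightarrow> ('g, 'm) iter" where
  "Gamma_unit G M x = Fn (\<lambda>g\<in>carrier G. act M g x)"

definition Gamma_pow ::
    "'g topgroup \<Rightarrow> ('g, 'm) top_gmod \<Rightarrow> nat \<Rightarrow> ('g, ('g, 'm) iter) top_gmod" where
  "Gamma_pow G M k = (Gamma G ^^ k) (lift_module M)"

text \<open>The \<open>m\<close>-cosimplices are \<open>Gamma_pow G M (m + 1)\<close>; codegeneracies do not enter the complex.\<close>

definition coface ::
    "'g topgroup \<Rightarrow> ('g, 'm) top_gmod \<Rightarrow> nat \<Rightarrow> nat \<Rightarrow> ('g, 'm) iter \<Rightarrow> ('g, 'm) iter" where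
  "coface G M m j = (Gamma_map G ^^ j) (Gamma_unit G (Gamma_pow G M (m + 1 - j)))"

definition Gamma_diff ::
    "'g topgroup \<Rightarrow> ('g, 'm) top_gmod \<Rightarrow> nat \<Rightarrow> ('g, 'm) iter \<Rightarrow> ('g, 'm) iter" where
  "Gamma_diff G M m x =
     finprod (Gamma_pow G M (m + 2))
       (\<lambda>j. coface G M m j x [^]\<^bsub>Gamma_pow G M (m + 2)\<^esub> ((-1 :: int) ^ j)) {..m + 1}"


section \<open>Towers, their limits, and the pro-discrete cochain complex\<close>

text \<open>The structure maps of a tower are \<open>\<phi> i : M (i + 1) \<rightarrow> M i\<close>.\<close>

definition lim_group ::
    "(nat \<Rightarrow> ('a, 'z) monoid_scheme) \<Rightarrow> (nat \<Rightarrow> 'a \<Rightarrow> 'a) \<Rightarrow> (nat \<Rightarrow> 'a) monoid" where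
  "lim_group A \<phi> =
     (product_group UNIV A)
       \<lparr>carrier := {x \<in> carrier (product_group UNIV A). \<forall>i. \<phi> i (x (Suc i)) = x i}\<rparr>"

definition lim_module ::
    "(nat \<Rightarrow> ('g, 'm) top_gmod) \<Rightarrow> (nat \<Rightarrow> 'm \<Rightarrow> 'm) \<Rightarrow> ('g, nat \<Rightarrow> 'm) top_gmod" where
  "lim_module M \<phi> =
     \<lparr>carrier = carrier (lim_group M \<phi>),
      monoid.mult = monoid.mult (lim_group M \<phi>),
      one = one (lim_group M \<phi>),
      act = (\<lambda>g x i. act (M i) g (x i)),
      mtop = subtopology (product_topology (\<lambda>i. mtop (M i)) UNIV) (carrier (lim_group M \<phi>))\<rparr>"

definition prodiscrete_complex ::
    "'g topgroup \<Rightarrow> (nat \<Rightarrow> ('g, 'm) top_gmod) \<Rightarrow> (nat \<Rightarrow> 'm \<Rightarrow> 'm) \<Rightarrow>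
     nat \<Rightarrow> (nat \<Rightarrow> ('g, 'm) iter) monoid" where
  "prodiscrete_complex G M \<phi> n =
     lim_group (\<lambda>i. fixed_points G (Gamma_pow G (M i) (n + 1)))
       (\<lambda>i. (Gamma_map G ^^ (n + 1)) (lift_map (\<phi> i)))"

definition prodiscrete_diff ::
    "'g topgroup \<Rightarrow> (nat \<Rightarrow> ('g, 'm) top_gmod) \<Rightarrow>
     nat \<Rightarrow> (nat \<Rightarrow> ('g, 'm) iter) \<Rightarrow> nat \<Rightarrow> ('g, 'm) iter" where
  "prodiscrete_diff G M n x = (\<lambda>i. Gamma_diff G (M i) n (x i))"

end

theory Submission
  imports Defs
begin

text \<open>
  The two complexes are already isomorphic as cochain complexes.

  An element of \<open>\<Gamma>\<^sup>n\<^sup>+\<^sup>1 M\<close> is an iterated map \<open>F(a\<^sub>0)(a\<^sub>1)\<dots>(a\<^sub>n)\<close>, locally constant at every stage.  For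
  compact \<open>G\<close> this is the same thing as a locally constant function of the tuple \<open>(a\<^sub>0, \<dots>, a\<^sub>n)\<close>
  (\<open>curry_iter_closed\<close>, \<open>curry_iter_surj\<close>).  Under this identification the coface
  \<open>d\<^sup>j = \<Gamma>\<^sup>j \<eta> \<Gamma>\<^sup>n\<^sup>+\<^sup>1\<^sup>-\<^sup>j\<close> replaces the adjacent entries \<open>a\<^sub>j, a\<^sub>j\<^sub>+\<^sub>1\<close> by the product \<open>a\<^sub>j\<^sub>+\<^sub>1 a\<^sub>j\<close> if
  \<open>j \<le> n\<close>, while the last one drops \<open>a\<^sub>n\<^sub>+\<^sub>1\<close> and lets it act on the value (\<open>coface_curry_iter\<close>).
  In terms of the products \<open>q\<^sub>i = a\<^sub>i \<dots> a\<^sub>0\<close>, merging \<open>a\<^sub>j\<close> with \<open>a\<^sub>j\<^sub>+\<^sub>1\<close> simply omits \<open>q\<^sub>j\<close>.  Hence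

    \<open>f \<mapsto> F\<close>,  \<open>F(a\<^sub>0)\<dots>(a\<^sub>n) = q\<^sub>n \<cdot> f(q\<^sub>0\<^sup>-\<^sup>1, \<dots>, q\<^sub>n\<^sup>-\<^sup>1)\<close>,

  carries the omission of argument \<open>j\<close> (counted from \<open>0\<close>) in a homogeneous cochain to \<open>d\<^sup>j\<close>, also for the last
  coface, because \<open>a\<^sub>n\<^sub>+\<^sub>1 q\<^sub>n = q\<^sub>n\<^sub>+\<^sub>1\<close> (\<open>cochain_to_Gamma_face\<close>).  Right translation of \<open>a\<^sub>0\<close> by \<open>h\<close>
  multiplies every \<open>q\<^sub>i\<close> by \<open>h\<close> on the right, so the map is also \<open>G\<close>-equivariant
  (\<open>cochain_to_Gamma_act\<close>).  It is bijective, since a tuple is recovered from the inverses of its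
  products, and natural in \<open>M\<close>.  For every discrete module it therefore restricts to an isomorphism
  \<open>X\<^sup>*(G; M)\<^sup>G \<cong> (\<Gamma>\<^sup>* M)\<^sup>G\<close>.

  A map into \<open>lim\<^sub>i M\<^sub>i\<close> with the limit topology is continuous iff all its components are, so
  homogeneous cochains with values in the limit are compatible families of cochains with values in
  the \<open>M\<^sub>i\<close>.  By naturality, applying the isomorphism for each \<open>M\<^sub>i\<close> to the components gives an
  isomorphism onto the limit of the \<open>(\<Gamma>\<^sup>* M\<^sub>i)\<^sup>G\<close> (\<open>comparison_bij\<close>), and hence one on cohomology.
\<close>

section \<open>Isomorphic complexes have isomorphic cohomology\<close>

text \<open>
  The cohomology of a complex is defined by cosets of the raw sets of cocycles and coboundaries, so
  taking images under the chain isomorphism is already a bijection on cosets.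
\<close>

lemma cochain_cohomology_iso:
  fixes C :: "nat \<Rightarrow> ('a, 'y) monoid_scheme" and D :: "nat \<Rightarrow> ('b, 'z) monoid_scheme"
  assumes bij: "\<And>n. bij_betw (h n) (carrier (C n)) (carrier (D n))"
    and one_closed: "\<And>n. \<one>\<^bsub>C n\<^esub> \<in> carrier (C n)"
    and mult_closed: "\<And>n x y. x \<in> carrier (C n) \<Longrightarrow> y \<in> carrier (C n) \<Longrightarrow> x \<otimes>\<^bsub>C n\<^esub> y \<in> carrier (C n)"
    and d_closed: "\<And>n x. x \<in> carrier (C n) \<Longrightarrow> d n x \<in> carrier (C (Suc n))"
    and h_one: "\<And>n. h n \<one>\<^bsub>C n\<^esub> = \<one>\<^bsub>D n\<^esub>"
    and h_mult: "\<And>n x y. x \<in> carrier (C n) \<Longrightarrow> y \<in> carrier (C n) \<Longrightarrow>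
                   h n (x \<otimes>\<^bsub>C n\<^esub> y) = h n x \<otimes>\<^bsub>D n\<^esub> h n y"
    and h_d: "\<And>n x. x \<in> carrier (C n) \<Longrightarrow> h (Suc n) (d n x) = e n (h n x)"
  shows "cochain_cohomology C d s \<cong> cochain_cohomology D e s"
proof -
  let ?Z = "kernel (C s) (C (Suc s)) (d s)" and ?W = "kernel (D s) (D (Suc s)) (e s)"
  let ?B = "coboundaries C d s" and ?E = "coboundaries D e s"
  have Z: "?Z \<subseteq> carrier (C s)" by (auto simp: kernel_def)
  have B: "?B \<subseteq> carrier (C s)"
    by (auto simp: coboundaries_def one_closed d_closed split: nat.split)
  have inj: "\<And>n. inj_on (h n) (carrier (C n))" and im: "\<And>n. h n ` carrier (C n) = carrier (D n)"
    using bij by (auto simp: bij_betw_def)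
  have hB: "h s ` ?B = ?E"
  proof (cases s)
    case 0
    then show ?thesis by (simp add: coboundaries_def h_one)
  next
    case (Suc r)
    have "h s ` d r ` carrier (C r) = e r ` h r ` carrier (C r)"
      unfolding image_image Suc by (rule image_cong) (auto simp: h_d)
    then show ?thesis by (simp add: coboundaries_def Suc im)
  qed
  have ker: "e s (h s x) = \<one>\<^bsub>D (Suc s)\<^esub> \<longleftrightarrow> d s x = \<one>\<^bsub>C (Suc s)\<^esub>" if "x \<in> carrier (C s)" for x
    using inj_onD[OF inj[of "Suc s"], of "d s x" "\<one>\<^bsub>C (Suc s)\<^esub>"] that
    by (auto simp: h_d[symmetric] h_one d_closed one_closed)
  have hZ: "h s ` ?Z = ?W"
    unfolding kernel_def im[symmetric] using ker by blast
  have coset: "h s ` (?B #>\<^bsub>C s\<lparr>carrier := ?Z\<rparr>\<^esub> x) = ?E #>\<^bsub>D s\<lparr>carrier := ?W\<rparr>\<^esub> h s x"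
    if "x \<in> ?Z" for x
  proof -
    have "h s (b \<otimes>\<^bsub>C s\<^esub> x) = h s b \<otimes>\<^bsub>D s\<^esub> h s x" if "b \<in> ?B" for b
      using that \<open>x \<in> ?Z\<close> B Z by (auto intro!: h_mult)
    then show ?thesis unfolding r_coset_def hB[symmetric] by (auto simp: image_iff)
  qed
  have coset_sub: "?B #>\<^bsub>C s\<lparr>carrier := ?Z\<rparr>\<^esub> x \<subseteq> carrier (C s)" if "x \<in> ?Z" for x
    using that B Z by (auto simp: r_coset_def intro!: mult_closed)
  let ?Q = "cochain_cohomology C d s" and ?R = "cochain_cohomology D e s"
  have cQ: "carrier ?Q = (\<lambda>x. ?B #>\<^bsub>C s\<lparr>carrier := ?Z\<rparr>\<^esub> x) ` ?Z"
    by (simp add: cochain_cohomology_def carrier_FactGroup)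
  have cR: "carrier ?R = (\<lambda>x. ?E #>\<^bsub>D s\<lparr>carrier := ?W\<rparr>\<^esub> x) ` ?W"
    by (simp add: cochain_cohomology_def carrier_FactGroup)
  have sub: "U \<subseteq> carrier (C s)" if "U \<in> carrier ?Q" for U
    using that coset_sub unfolding cQ by blast
  have "(\<lambda>U. h s ` U) ` carrier ?Q = (\<lambda>x. ?E #>\<^bsub>D s\<lparr>carrier := ?W\<rparr>\<^esub> h s x) ` ?Z"
    unfolding cQ image_image by (rule image_cong[OF refl]) (rule coset)
  also have "\<dots> = carrier ?R"
    unfolding cR hZ[symmetric] image_image ..
  finally have surj: "(\<lambda>U. h s ` U) ` carrier ?Q = carrier ?R" .
  moreover have "inj_on (\<lambda>U. h s ` U) (carrier ?Q)"
    by (rule inj_onI) (metis inj sub inj_on_image_eq_iff)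
  moreover have "h s ` (U \<otimes>\<^bsub>?Q\<^esub> V) = h s ` U \<otimes>\<^bsub>?R\<^esub> h s ` V"
    if "U \<in> carrier ?Q" "V \<in> carrier ?Q" for U V
  proof -
    have "h s (u \<otimes>\<^bsub>C s\<^esub> v) = h s u \<otimes>\<^bsub>D s\<^esub> h s v" if "u \<in> U" "v \<in> V" for u v
      using that sub[OF \<open>U \<in> _\<close>] sub[OF \<open>V \<in> _\<close>] by (auto intro!: h_mult)
    then show ?thesis
      by (auto simp: cochain_cohomology_def FactGroup_def set_mult_def image_iff) blast
  qed
  ultimately have "(\<lambda>U. h s ` U) \<in> iso ?Q ?R"
    unfolding iso_iff hom_def by auto
  then show ?thesis by (rule is_isoI)
qed

section \<open>Homomorphisms and signed products\<close>

text \<open>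
  Both differentials are alternating sums, written multiplicatively as products of powers with
  exponents \<open>\<plusminus>1\<close>.  This lemma moves evaluation, projections, module actions and the comparison map
  through them.
\<close>

lemma hom_signed_finprod:
  assumes A: "comm_group A" and B: "comm_group B" and h: "h \<in> hom A B"
    and f: "f \<in> J \<rightarrow> carrier A"
  shows "h (finprod A (\<lambda>j. f j [^]\<^bsub>A\<^esub> (\<epsilon> j :: int)) J) = finprod B (\<lambda>j. h (f j) [^]\<^bsub>B\<^esub> \<epsilon> j) J"
proof -
  interpret A: comm_group A by fact
  interpret B: comm_group B by fact
  have one: "h \<one>\<^bsub>A\<^esub> = \<one>\<^bsub>B\<^esub>" by (rule hom_one) (use h in auto)
  have cl: "x \<in> carrier A \<Longrightarrow> h x \<in> carrier B" for x using h by (auto simp: hom_def)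
  have pow: "x \<in> carrier A \<Longrightarrow> h (x [^]\<^bsub>A\<^esub> n) = h x [^]\<^bsub>B\<^esub> n" for x and n :: int
    using hom_int_pow[OF h] by simp
  show ?thesis
    using f
  proof (induction J rule: infinite_finite_induct)
    case (insert j J)
    then have "h (finprod A (\<lambda>j. f j [^]\<^bsub>A\<^esub> \<epsilon> j) (insert j J))
        = h (f j [^]\<^bsub>A\<^esub> \<epsilon> j \<otimes>\<^bsub>A\<^esub> finprod A (\<lambda>j. f j [^]\<^bsub>A\<^esub> \<epsilon> j) J)"
      by (subst A.finprod_insert) auto
    also have "\<dots> = h (f j [^]\<^bsub>A\<^esub> \<epsilon> j) \<otimes>\<^bsub>B\<^esub> h (finprod A (\<lambda>j. f j [^]\<^bsub>A\<^esub> \<epsilon> j) J)"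
      using insert.prems by (intro hom_mult[OF h]) (auto intro!: A.finprod_closed)
    also have "\<dots> = h (f j) [^]\<^bsub>B\<^esub> \<epsilon> j \<otimes>\<^bsub>B\<^esub> finprod B (\<lambda>j. h (f j) [^]\<^bsub>B\<^esub> \<epsilon> j) J"
      using insert by (simp add: pow Pi_iff)
    also have "\<dots> = finprod B (\<lambda>j. h (f j) [^]\<^bsub>B\<^esub> \<epsilon> j) (insert j J)"
      using insert by (subst B.finprod_insert) (auto simp: cl Pi_iff)
    finally show ?case .
  qed (auto simp: one)
qed

lemma comm_group_surj_hom:
  assumes A: "comm_group A"
    and surj: "h ` carrier A = carrier B"
    and one: "h \<one>\<^bsub>A\<^esub> = \<one>\<^bsub>B\<^esub>"
    and mult: "\<And>x y. x \<in> carrier A \<Longrightarrow> y \<in> carrier A \<Longrightarrow> h (x \<otimes>\<^bsub>A\<^esub> y) = h x \<otimes>\<^bsub>B\<^esub> h y"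
  shows "comm_group B"
proof -
  interpret A: comm_group A by fact
  have ex: "\<exists>a\<in>carrier A. x = h a" if "x \<in> carrier B" for x using that surj by auto
  have cl: "a \<in> carrier A \<Longrightarrow> h a \<in> carrier B" for a using surj by auto
  show ?thesis
  proof (rule comm_groupI)
    fix x y assume "x \<in> carrier B" "y \<in> carrier B"
    then obtain a b where "a \<in> carrier A" "b \<in> carrier A" "x = h a" "y = h b" using ex by meson
    then show "x \<otimes>\<^bsub>B\<^esub> y \<in> carrier B" "x \<otimes>\<^bsub>B\<^esub> y = y \<otimes>\<^bsub>B\<^esub> x"
      by (auto simp: mult[symmetric] cl A.m_comm)
  next
    show "\<one>\<^bsub>B\<^esub> \<in> carrier B" using cl[OF A.one_closed] one by simp
  next
    fix x y z assume "x \<in> carrier B" "y \<in> carrier B" "z \<in> carrier B"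
    then obtain a b c where "a \<in> carrier A" "b \<in> carrier A" "c \<in> carrier A"
      "x = h a" "y = h b" "z = h c" using ex by meson
    then show "x \<otimes>\<^bsub>B\<^esub> y \<otimes>\<^bsub>B\<^esub> z = x \<otimes>\<^bsub>B\<^esub> (y \<otimes>\<^bsub>B\<^esub> z)"
      by (simp add: mult[symmetric] A.m_assoc)
  next
    fix x assume "x \<in> carrier B"
    then obtain a where a: "a \<in> carrier A" "x = h a" using ex by meson
    then show "\<one>\<^bsub>B\<^esub> \<otimes>\<^bsub>B\<^esub> x = x" by (simp add: one[symmetric] mult[symmetric])
    show "\<exists>y\<in>carrier B. y \<otimes>\<^bsub>B\<^esub> x = \<one>\<^bsub>B\<^esub>"
      using a by (intro bexI[of _ "h (inv\<^bsub>A\<^esub> a)"]) (auto simp: one[symmetric] mult[symmetric] cl)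
  qed
qed

section \<open>Locally constant maps\<close>

lemma continuous_map_discrete_iff:
  "continuous_map X (discrete_topology S) f \<longleftrightarrow>
     f \<in> topspace X \<rightarrow> S \<and>
     (\<forall>x\<in>topspace X. \<exists>U. openin X U \<and> x \<in> U \<and> (\<forall>y\<in>U. f y = f x))" (is "?L \<longleftrightarrow> ?S \<and> ?R")
proof (intro iffI conjI)
  assume L: ?L
  then show f: ?S by (simp add: continuous_map_def)
  show ?R
  proof
    fix x assume x: "x \<in> topspace X"
    have "openin X {y \<in> topspace X. f y \<in> {f x}}"
      by (rule openin_continuous_map_preimage[OF L]) (use f x in auto)
    moreover have "x \<in> {y \<in> topspace X. f y \<in> {f x}}" using x by simp
    moreover have "\<forall>y\<in>{y \<in> topspace X. f y \<in> {f x}}. f y = f x" by simp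
    ultimately show "\<exists>U. openin X U \<and> x \<in> U \<and> (\<forall>y\<in>U. f y = f x)" by meson
  qed
next
  assume SR: "?S \<and> ?R"
  have "openin X {x \<in> topspace X. f x \<in> V}" for V
  proof (subst openin_subopen, intro ballI)
    fix x assume x: "x \<in> {x \<in> topspace X. f x \<in> V}"
    then have "x \<in> topspace X" by simp
    with SR obtain U where U: "openin X U" "x \<in> U" "\<forall>y\<in>U. f y = f x" by meson
    have "y \<in> {x \<in> topspace X. f x \<in> V}" if "y \<in> U" for y
      using bspec[OF U(3) that] x that openin_subset[OF U(1)] by auto
    then have "U \<subseteq> {x \<in> topspace X. f x \<in> V}" ..
    with U(1,2) show "\<exists>T. openin X T \<and> x \<in> T \<and> T \<subseteq> {x \<in> topspace X. f x \<in> V}" by meson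
  qed
  then show ?L using SR by (simp add: continuous_map_def)
qed

lemma continuous_map_discrete_combine:
  assumes f: "continuous_map X (discrete_topology S) f" and g: "continuous_map X (discrete_topology T) g"
    and op: "\<And>x y. x \<in> S \<Longrightarrow> y \<in> T \<Longrightarrow> p x y \<in> R"
  shows "continuous_map X (discrete_topology R) (\<lambda>x. p (f x) (g x))"
proof -
  have "continuous_map X (discrete_topology (S \<times> T)) (\<lambda>x. (f x, g x))"
    unfolding prod_topology_discrete_topology using f g by (rule continuous_map_pairedI)
  then have "continuous_map X (discrete_topology R) ((\<lambda>(x, y). p x y) \<circ> (\<lambda>x. (f x, g x)))"
    by (rule continuous_map_compose) (auto intro: op)
  then show ?thesis by (simp add: o_def)
qed

lemma continuous_map_restrict_topspace:
  "S = topspace X \<Longrightarrow> continuous_map X Y (restrict f S) \<longleftrightarrow> continuous_map X Y f"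
  using continuous_map_eq[of X Y "restrict f S" f] continuous_map_eq[of X Y f "restrict f S"] by auto

text \<open>
  The place where compactness of \<open>G\<close> enters.  The points where \<open>f\<close> differs from its slice at \<open>x0\<close>
  form a closed set, and projection along a compact factor is a closed map; the complement of the
  image is the required neighbourhood.
\<close>

lemma slice_locally_constant:
  assumes Y: "compact_space Y"
    and f: "continuous_map (prod_topology X Y) (discrete_topology S) f" and x0: "x0 \<in> topspace X"
  shows "\<exists>U. openin X U \<and> x0 \<in> U \<and> (\<forall>x\<in>U. \<forall>y\<in>topspace Y. f (x, y) = f (x0, y))"
proof -
  let ?P = "prod_topology X Y"
  have "continuous_map ?P ?P (\<lambda>p. (x0, snd p))"
    using x0 by (intro continuous_map_pairedI) (auto simp: continuous_map_snd)
  from continuous_map_compose[OF this f]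
  have "continuous_map ?P (discrete_topology S) (\<lambda>p. f (x0, snd p))" by (simp add: o_def)
  then have "continuous_map ?P (discrete_topology UNIV) (\<lambda>p. f p = f (x0, snd p))"
    by (rule continuous_map_discrete_combine[OF f]) simp
  then have "closedin ?P {p \<in> topspace ?P. (f p = f (x0, snd p)) \<in> {False}}"
    by (rule closedin_continuous_map_preimage) simp
  then have "closedin X (fst ` {p \<in> topspace ?P. (f p = f (x0, snd p)) \<in> {False}})"
    using Abstract_Topological_Spaces.closed_map_fst[OF Y, of X] by (auto simp: closed_map_def)
  then have "openin X (topspace X - fst ` {p \<in> topspace ?P. (f p = f (x0, snd p)) \<in> {False}})"
    (is "openin X ?U") by (simp add: closedin_def)
  moreover have "x0 \<in> ?U" using x0 by auto
  moreover have "f (x, y) = f (x0, y)" if "x \<in> ?U" "y \<in> topspace Y" for x y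
  proof (rule ccontr)
    assume "f (x, y) \<noteq> f (x0, y)"
    then have "(x, y) \<in> {p \<in> topspace ?P. (f p = f (x0, snd p)) \<in> {False}}" using that by simp
    then have "x \<in> fst ` {p \<in> topspace ?P. (f p = f (x0, snd p)) \<in> {False}}"
      by (rule image_eqI[rotated]) simp
    with that(1) show False by blast
  qed
  ultimately show ?thesis by blast
qed

section \<open>Currying\<close>

abbreviation cube :: "'g topgroup \<Rightarrow> nat \<Rightarrow> (nat \<Rightarrow> 'g) set" where
  "cube G k \<equiv> (\<Pi>\<^sub>E i\<in>{..<k}. carrier G)"

abbreviation cube_top :: "'g topgroup \<Rightarrow> nat \<Rightarrow> (nat \<Rightarrow> 'g) topology" where
  "cube_top G k \<equiv> product_topology (\<lambda>i. gtop G) {..<k}"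

text \<open>
  In a function of tuples all coordinates are on the same footing, so that substitutions of
  variables become manageable; in an element of \<open>\<Gamma>\<^sup>k M\<close> they sit at different depths of nesting.
  Only the values of \<open>f\<close> on \<open>cube G k\<close> matter: the constant \<open>undefined\<close> function in the base case
  is the unique extensional tuple of length \<open>0\<close>.
\<close>

primrec curry_iter :: "'g topgroup \<Rightarrow> nat \<Rightarrow> ((nat \<Rightarrow> 'g) \<Rightarrow> 'm) \<Rightarrow> ('g, 'm) iter" where
  "curry_iter G 0 f = Val (f (\<lambda>_. undefined))"
| "curry_iter G (Suc k) f = Fn (\<lambda>g\<in>carrier G. curry_iter G k (\<lambda>a. f (case_nat g a)))"

lemma cube_0: "cube G 0 = {\<lambda>_. undefined}"
  by simp

lemma case_nat_in_cube: "g \<in> carrier G \<Longrightarrow> a \<in> cube G k \<Longrightarrow> case_nat g a \<in> cube G (Suc k)"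
  by (auto simp: PiE_iff extensional_def split: nat.split)

lemma tail_in_cube: "a \<in> cube G (Suc k) \<Longrightarrow> (\<lambda>i. a (Suc i)) \<in> cube G k"
  by (auto simp: PiE_iff extensional_def)

lemma case_nat_tail: "case_nat (a 0) (\<lambda>i. a (Suc i)) = a"
  by (auto split: nat.split)

lemma curry_iter_cong:
  "(\<And>a. a \<in> cube G k \<Longrightarrow> f a = f' a) \<Longrightarrow> curry_iter G k f = curry_iter G k f'"
proof (induction k arbitrary: f f')
  case (Suc k)
  have "curry_iter G k (\<lambda>a. f (case_nat g a)) = curry_iter G k (\<lambda>a. f' (case_nat g a))"
    if "g \<in> carrier G" for g
    by (rule Suc.IH, rule Suc.prems, rule case_nat_in_cube[OF that])
  then show ?case by (simp cong: restrict_cong)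
qed (simp add: cube_0)

lemma curry_iter_inject:
  "curry_iter G k f = curry_iter G k f' \<Longrightarrow> a \<in> cube G k \<Longrightarrow> f a = f' a"
proof (induction k arbitrary: f f' a)
  case (Suc k)
  have a0: "a 0 \<in> carrier G" using Suc.prems(2) by (auto simp: PiE_iff)
  have "(\<lambda>g\<in>carrier G. curry_iter G k (\<lambda>a. f (case_nat g a))) (a 0) =
        (\<lambda>g\<in>carrier G. curry_iter G k (\<lambda>a. f' (case_nat g a))) (a 0)"
    using Suc.prems(1) by simp
  then have "curry_iter G k (\<lambda>b. f (case_nat (a 0) b)) = curry_iter G k (\<lambda>b. f' (case_nat (a 0) b))"
    using a0 by simp
  from Suc.IH[OF this tail_in_cube[OF Suc.prems(2)]] show ?case by (simp only: case_nat_tail)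
qed (simp add: cube_0)

lemma Gamma_pow_0: "Gamma_pow G M 0 = lift_module M"
  and Gamma_pow_Suc: "Gamma_pow G M (Suc k) = Gamma G (Gamma_pow G M k)"
  by (simp_all add: Gamma_pow_def)

lemma curry_iter_mult:
  "curry_iter G k (\<lambda>a. f a \<otimes>\<^bsub>M\<^esub> f' a) = curry_iter G k f \<otimes>\<^bsub>Gamma_pow G M k\<^esub> curry_iter G k f'"
proof (induction k arbitrary: f f')
  case 0
  then show ?case by (simp add: Gamma_pow_0 lift_module_def)
next
  case (Suc k)
  show ?case
    by (simp add: Gamma_pow_Suc Gamma_def Suc.IH cong: restrict_cong)
qed

lemma curry_iter_one: "curry_iter G k (\<lambda>a. \<one>\<^bsub>M\<^esub>) = \<one>\<^bsub>Gamma_pow G M k\<^esub>"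
  by (induction k) (simp_all add: Gamma_pow_0 lift_module_def Gamma_pow_Suc Gamma_def)

lemma Gamma_map_Fn: "Gamma_map G \<phi> (Fn (restrict F (carrier G))) = Fn (\<lambda>g\<in>carrier G. \<phi> (F g))"
  by (simp add: Gamma_map_def cong: restrict_cong)

lemma curry_iter_natural:
  "(Gamma_map G ^^ k) (lift_map \<phi>) (curry_iter G k f) = curry_iter G k (\<lambda>a. \<phi> (f a))"
proof (induction k arbitrary: f)
  case (Suc k)
  show ?case by (simp add: Gamma_map_Fn Suc.IH cong: restrict_cong)
qed (simp add: lift_map_def)

text \<open>
  The substitution of variables behind the coface with index \<open>j\<close>.  The factors appear in reverse
  order because \<open>G\<close> acts on \<open>\<Gamma>\<close> by right translation.
\<close>

definition merge :: "'g topgroup \<Rightarrow> nat \<Rightarrow> (nat \<Rightarrow> 'g) \<Rightarrow> nat \<Rightarrow> 'g" where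
  "merge G j a i = (if i < j then a i else if i = j then a (Suc j) \<otimes>\<^bsub>G\<^esub> a j else a (Suc i))"

lemma merge_case_nat:
  "merge G (Suc j) (case_nat g a) = case_nat g (merge G j a)"
  "merge G 0 (case_nat g (case_nat g' a)) = case_nat (g' \<otimes>\<^bsub>G\<^esub> g) a"
  by (auto simp: merge_def fun_eq_iff split: nat.split)

lemma restrict_case_nat: "restrict (case_nat g a) {..<Suc k} = case_nat g (restrict a {..<k})"
  by (auto simp: restrict_def fun_eq_iff split: nat.split)

locale compact_group =
  fixes G :: "'g topgroup" (structure)
  assumes topological: "topological_group G (gtop G)" and compact: "compact_space (gtop G)"
begin

sublocale group G
  using topological by (simp add: topological_group_def)

lemma topspace_gtop [simp]: "topspace (gtop G) = carrier G"
  using topological by (simp add: topological_group_def)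

lemma topspace_cube: "topspace (cube_top G k) = cube G k"
  by simp

lemma continuous_map_mult:
  assumes "continuous_map X (gtop G) f" "continuous_map X (gtop G) g"
  shows "continuous_map X (gtop G) (\<lambda>x. f x \<otimes> g x)"
proof -
  have "continuous_map X (gtop G) ((\<lambda>(x, y). x \<otimes> y) \<circ> (\<lambda>x. (f x, g x)))"
    using topological assms unfolding topological_group_def
    by (intro continuous_map_compose[OF continuous_map_pairedI]) auto
  then show ?thesis by (simp add: o_def)
qed

lemma continuous_map_inv:
  assumes "continuous_map X (gtop G) f"
  shows "continuous_map X (gtop G) (\<lambda>x. inv (f x))"
proof -
  have "continuous_map X (gtop G) ((\<lambda>x. inv x) \<circ> f)"
    using topological assms unfolding topological_group_def
    by (intro continuous_map_compose[OF assms]) auto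
  then show ?thesis by (simp add: o_def)
qed

lemma compact_cube: "compact_space (cube_top G k)"
  by (simp add: compact_space_product_topology compact)

lemma continuous_map_case_nat:
  "continuous_map (prod_topology (gtop G) (cube_top G k)) (cube_top G (Suc k)) (\<lambda>(g, a). case_nat g a)"
proof -
  have comp: "continuous_map (prod_topology (gtop G) (cube_top G k)) (gtop G) (\<lambda>p. case_nat (fst p) (snd p) i)"
    if "i \<in> {..<Suc k}" for i
  proof (cases i)
    case 0
    then show ?thesis by (simp add: continuous_map_fst)
  next
    case (Suc j)
    with that have "continuous_map (prod_topology (gtop G) (cube_top G k)) (gtop G) ((\<lambda>a. a j) \<circ> snd)"
      by (intro continuous_map_compose[OF continuous_map_snd] continuous_map_product_projection) simp
    then show ?thesis by (simp add: Suc o_def)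
  qed
  have ext: "case_nat (fst p) (snd p) \<in> extensional {..<Suc k}"
    if "p \<in> carrier G \<times> cube G k" for p
  proof -
    from that have "fst p \<in> carrier G" "snd p \<in> cube G k" by (simp_all only: mem_Times_iff)
    then have "case_nat (fst p) (snd p) \<in> cube G (Suc k)" by (rule case_nat_in_cube)
    then show ?thesis by (simp only: PiE_def Int_iff)
  qed
  show ?thesis
    unfolding continuous_map_componentwise case_prod_beta'
  proof (intro conjI image_subsetI ballI)
    fix p assume "p \<in> topspace (prod_topology (gtop G) (cube_top G k))"
    then have "p \<in> carrier G \<times> cube G k" by simp
    then show "case_nat (fst p) (snd p) \<in> extensional {..<Suc k}" by (rule ext)
  qed (rule comp)
qed

lemma continuous_map_tail:
  "continuous_map (cube_top G (Suc k)) (cube_top G k) (\<lambda>a i. a (Suc i))"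
proof -
  have "continuous_map (cube_top G (Suc k)) (gtop G) (\<lambda>a. a (Suc i))" if "i < k" for i
    using that by (intro continuous_map_product_projection) simp
  then show ?thesis
    by (auto simp: continuous_map_componentwise PiE_iff extensional_def)
qed

end

locale compact_group_module = compact_group G for G :: "'g topgroup" (structure) +
  fixes M :: "('g, 'm) top_gmod"
  assumes discrete_module: "discrete_module G M"
begin

sublocale M: comm_group M
  using discrete_module by (simp add: discrete_module_def topological_module_def)

lemma mtop: "mtop M = discrete_topology (carrier M)"
  using discrete_module by (simp add: discrete_module_def)

lemma act_hom: "g \<in> carrier G \<Longrightarrow> act M g \<in> hom M M"
  and act_one: "x \<in> carrier M \<Longrightarrow> act M \<one> x = x"
  and act_mult: "g \<in> carrier G \<Longrightarrow> h \<in> carrier G \<Longrightarrow> x \<in> carrier M \<Longrightarrow>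
        act M g (act M h x) = act M (g \<otimes> h) x"
  using discrete_module by (auto simp: discrete_module_def topological_module_def)

lemma act_closed: "g \<in> carrier G \<Longrightarrow> x \<in> carrier M \<Longrightarrow> act M g x \<in> carrier M"
  using act_hom by (auto simp: hom_def)

lemma continuous_map_act:
  assumes "continuous_map X (gtop G) f" "continuous_map X (mtop M) g"
  shows "continuous_map X (mtop M) (\<lambda>x. act M (f x) (g x))"
proof -
  have "continuous_map X (mtop M) ((\<lambda>(x, y). act M x y) \<circ> (\<lambda>x. (f x, g x)))"
    using discrete_module assms unfolding discrete_module_def topological_module_def
    by (intro continuous_map_compose[OF continuous_map_pairedI]) auto
  then show ?thesis by (simp add: o_def)
qed

lemma mtop_Gamma_pow: "mtop (Gamma_pow G M k) = discrete_topology (carrier (Gamma_pow G M k))"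
proof (cases k)
  case 0
  have "pullback_topology (Val ` carrier M) un_Val (discrete_topology (carrier M)) =
        discrete_topology (Val ` carrier M)" (is "?T = _")
  proof -
    have "openin ?T {Val x}" if "x \<in> carrier M" for x
      unfolding openin_pullback_topology using that by (intro exI[of _ "{x}"]) auto
    moreover have "topspace ?T = Val ` carrier M" by (auto simp: topspace_pullback_topology)
    ultimately show ?thesis by (subst eq_commute) (auto simp: discrete_topology_unique)
  qed
  then show ?thesis using 0 by (simp add: Gamma_pow_0 lift_module_def mtop)
next
  case (Suc k)
  then show ?thesis by (simp add: Gamma_pow_Suc Gamma_def)
qed

text \<open>
  A jointly locally constant function of \<open>k + 1\<close> variables gives a map from \<open>G\<close> to the discrete
  set \<open>\<Gamma>\<^sup>k M\<close>; local constancy of that map is uniformity over the remaining \<open>k\<close> variables, which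
  \<open>slice_locally_constant\<close> provides.
\<close>

lemma curry_iter_closed:
  "continuous_map (cube_top G k) (mtop M) f \<Longrightarrow> curry_iter G k f \<in> carrier (Gamma_pow G M k)"
proof (induction k arbitrary: f)
  case 0
  then have "f (\<lambda>_. undefined) \<in> carrier M"
    using continuous_map_image_subset_topspace[OF 0] by (simp add: mtop)
  then show ?case by (simp add: Gamma_pow_0 lift_module_def)
next
  case (Suc k)
  let ?F = "\<lambda>g. curry_iter G k (\<lambda>a. f (case_nat g a))"
  have f2: "continuous_map (prod_topology (gtop G) (cube_top G k)) (mtop M) (\<lambda>p. f (case_nat (fst p) (snd p)))"
    using continuous_map_compose[OF continuous_map_case_nat Suc.prems] by (simp add: o_def case_prod_beta')
  have slice: "continuous_map (cube_top G k) (mtop M) (\<lambda>a. f (case_nat g a))" if "g \<in> carrier G" for g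
  proof -
    have "continuous_map (cube_top G k) (prod_topology (gtop G) (cube_top G k)) (\<lambda>a. (g, a))"
      using that by (intro continuous_map_pairedI) auto
    from continuous_map_compose[OF this f2] show ?thesis by (simp add: o_def)
  qed
  have "continuous_map (gtop G) (discrete_topology (carrier (Gamma_pow G M k))) ?F"
    unfolding continuous_map_discrete_iff
  proof (intro conjI ballI)
    show "?F \<in> topspace (gtop G) \<rightarrow> carrier (Gamma_pow G M k)"
      using Suc.IH slice by auto
    fix g assume "g \<in> topspace (gtop G)"
    from slice_locally_constant[OF compact_cube f2[unfolded mtop] this]
    obtain U where U: "openin (gtop G) U" "g \<in> U"
      and eq: "\<And>h a. h \<in> U \<Longrightarrow> a \<in> cube G k \<Longrightarrow> f (case_nat h a) = f (case_nat g a)"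
      unfolding topspace_cube fst_conv snd_conv by meson
    have "?F h = ?F g" if "h \<in> U" for h
      by (rule curry_iter_cong, rule eq[OF that])
    with U show "\<exists>U. openin (gtop G) U \<and> g \<in> U \<and> (\<forall>h\<in>U. ?F h = ?F g)" by meson
  qed
  then show ?case
    by (simp add: Gamma_pow_Suc Gamma_def Gamma_carrier_def mtop_Gamma_pow
        continuous_map_restrict_topspace)
qed

text \<open>
  Conversely, near a tuple \<open>b\<close> the outermost map is constant in the first variable, and the inner
  function that it selects is locally constant in the others.
\<close>

lemma curry_iter_surj:
  "x \<in> carrier (Gamma_pow G M k) \<Longrightarrow>
     \<exists>f. continuous_map (cube_top G k) (mtop M) f \<and> curry_iter G k f = x"
proof (induction k arbitrary: x)
  case 0
  then obtain m where m: "m \<in> carrier M" "x = Val m" by (auto simp: Gamma_pow_0 lift_module_def)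
  then show ?case by (intro exI[of _ "\<lambda>_. m"]) (simp add: mtop)
next
  case (Suc k)
  let ?N = "Gamma_pow G M k"
  from Suc.prems obtain F where F: "F \<in> extensional (carrier G)" "x = Fn F"
    and cont: "continuous_map (gtop G) (discrete_topology (carrier ?N)) F"
    by (auto simp: Gamma_pow_Suc Gamma_def Gamma_carrier_def mtop_Gamma_pow)
  from Suc.IH obtain u where u: "\<And>v. v \<in> carrier ?N \<Longrightarrow> continuous_map (cube_top G k) (mtop M) (u v)"
    and cu: "\<And>v. v \<in> carrier ?N \<Longrightarrow> curry_iter G k (u v) = v"
    by metis
  have FN: "F g \<in> carrier ?N" if "g \<in> carrier G" for g
    using cont that by (auto simp: continuous_map_def)
  let ?f = "\<lambda>a. u (F (a 0)) (\<lambda>i. a (Suc i))"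
  have "continuous_map (cube_top G (Suc k)) (discrete_topology (carrier M)) ?f"
    unfolding continuous_map_discrete_iff topspace_cube
  proof (intro conjI ballI)
    show "?f \<in> cube G (Suc k) \<rightarrow> carrier M"
    proof
      fix a assume a: "a \<in> cube G (Suc k)"
      then have "F (a 0) \<in> carrier ?N" by (auto intro!: FN simp: PiE_iff)
      from u[OF this] show "?f a \<in> carrier M"
        using tail_in_cube[OF a] by (auto simp: continuous_map_def mtop Pi_iff)
    qed
    fix b assume b: "b \<in> cube G (Suc k)"
    then have b0: "b 0 \<in> carrier G" by (auto simp: PiE_iff)
    from cont b0 obtain U where U: "openin (gtop G) U" "b 0 \<in> U" and FU: "\<And>g. g \<in> U \<Longrightarrow> F g = F (b 0)"
      unfolding continuous_map_discrete_iff topspace_gtop by meson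
    from u[OF FN[OF b0]] tail_in_cube[OF b] obtain V
      where V: "openin (cube_top G k) V" "(\<lambda>i. b (Suc i)) \<in> V"
        and uV: "\<And>a. a \<in> V \<Longrightarrow> u (F (b 0)) a = ?f b"
      unfolding mtop continuous_map_discrete_iff topspace_cube by meson
    \<comment> \<open>On \<open>?W\<close> the first variable selects the same inner function as \<open>b\<close>, and on the remaining
      ones this function takes the same value as at \<open>b\<close>.\<close>
    let ?W = "{a \<in> topspace (cube_top G (Suc k)). a 0 \<in> U} \<inter>
              {a \<in> topspace (cube_top G (Suc k)). (\<lambda>i. a (Suc i)) \<in> V}"
    have "openin (cube_top G (Suc k)) ?W"
      by (intro openin_Int openin_continuous_map_preimage[OF _ U(1)]
          openin_continuous_map_preimage[OF continuous_map_tail V(1)]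
          continuous_map_product_projection) simp
    moreover have "b \<in> ?W" using b U(2) V(2) by simp
    moreover have "?f a = ?f b" if "a \<in> ?W" for a
    proof -
      from that have "a 0 \<in> U" "(\<lambda>i. a (Suc i)) \<in> V" by simp_all
      then show ?thesis by (simp only: FU uV)
    qed
    ultimately show "\<exists>W. openin (cube_top G (Suc k)) W \<and> b \<in> W \<and> (\<forall>a\<in>W. ?f a = ?f b)" by meson
  qed
  moreover have "curry_iter G (Suc k) ?f = x"
    using F FN cu by (simp add: extensional_restrict cong: restrict_cong)
  ultimately show ?case unfolding mtop by (intro exI[of _ ?f] conjI)
qed

text \<open>
  By induction on \<open>j\<close>: each application of \<open>\<Gamma>\<close> sets aside one variable, until the unit inserts a
  new variable \<open>g\<close> by letting it act.  On a value in \<open>\<Gamma>\<^sup>k\<^sup>-\<^sup>j M\<close> with \<open>k > j\<close> it acts by right translation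
  of the next variable, on a value in \<open>M\<close> itself by the given action.
\<close>

lemma coface_curry_iter:
  assumes "j \<le> k"
  shows "(Gamma_map G ^^ j) (Gamma_unit G (Gamma_pow G M (k - j))) (curry_iter G k f) =
    curry_iter G (Suc k) (\<lambda>a. if j < k then f (merge G j a) else act M (a k) (f (restrict a {..<k})))"
  using assms
proof (induction j arbitrary: k f)
  case 0
  show ?case
  proof (cases k)
    case 0
    then show ?thesis
      by (simp add: Gamma_unit_def Gamma_pow_0 lift_module_def restrict_def cong: if_cong)
  next
    case (Suc k')
    then show ?thesis
      by (simp add: Gamma_unit_def Gamma_pow_Suc Gamma_def merge_case_nat cong: restrict_cong)
  qed
next
  case (Suc j)
  then obtain k' where k: "k = Suc k'" "j \<le> k'" by (cases k) auto
  show ?case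
    unfolding k(1) funpow.simps(2) o_apply diff_Suc_Suc curry_iter.simps(2)[of G k'] Gamma_map_Fn
      Suc.IH[OF k(2)] curry_iter.simps(2)[of G "Suc k'"]
    by (simp only: merge_case_nat restrict_case_nat nat.case Suc_less_eq)
qed

end

section \<open>Homogeneous cochains and iterated \<open>\<Gamma>\<close>\<close>

primrec prefix_prod :: "'g topgroup \<Rightarrow> (nat \<Rightarrow> 'g) \<Rightarrow> nat \<Rightarrow> 'g" where
  "prefix_prod G a 0 = a 0"
| "prefix_prod G a (Suc i) = a (Suc i) \<otimes>\<^bsub>G\<^esub> prefix_prod G a i"

text \<open>
  The coordinate change \<open>(a\<^sub>i) \<mapsto> (q\<^sub>i\<^sup>-\<^sup>1)\<close> with \<open>q\<^sub>i = a\<^sub>i \<dots> a\<^sub>0\<close>; \<open>inv_steps\<close> below is its inverse.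
\<close>

definition inv_prefixes :: "'g topgroup \<Rightarrow> nat \<Rightarrow> (nat \<Rightarrow> 'g) \<Rightarrow> nat \<Rightarrow> 'g" where
  "inv_prefixes G n a = (\<lambda>i\<in>{..n}. inv\<^bsub>G\<^esub> (prefix_prod G a i))"

definition inv_steps :: "'g topgroup \<Rightarrow> nat \<Rightarrow> (nat \<Rightarrow> 'g) \<Rightarrow> nat \<Rightarrow> 'g" where
  "inv_steps G n x =
     (\<lambda>i\<in>{..n}. case i of 0 \<Rightarrow> inv\<^bsub>G\<^esub> (x 0) | Suc j \<Rightarrow> inv\<^bsub>G\<^esub> (x i) \<otimes>\<^bsub>G\<^esub> x j)"

text \<open>
  On invariant cochains the result does not depend on \<open>a\<^sub>0\<close>, and as a function of the other
  variables it is an inhomogeneous cochain.  The version with \<open>a\<^sub>0\<close> is defined on all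
  cochains and is equivariant.
\<close>

definition dehomogenize ::
    "'g topgroup \<Rightarrow> ('g, 'm) top_gmod \<Rightarrow> nat \<Rightarrow> ((nat \<Rightarrow> 'g) \<Rightarrow> 'm) \<Rightarrow> (nat \<Rightarrow> 'g) \<Rightarrow> 'm" where
  "dehomogenize G M n f a = act M (prefix_prod G a n) (f (inv_prefixes G n a))"

definition cochain_to_Gamma ::
    "'g topgroup \<Rightarrow> ('g, 'm) top_gmod \<Rightarrow> nat \<Rightarrow> ((nat \<Rightarrow> 'g) \<Rightarrow> 'm) \<Rightarrow> ('g, 'm) iter" where
  "cochain_to_Gamma G M n f = curry_iter G (Suc n) (dehomogenize G M n f)"

lemma tuples_eq_cube: "tuples G n = cube G (Suc n)"
  by (simp add: tuples_def lessThan_Suc_atMost)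

lemma tuples_component: "x \<in> tuples G n \<Longrightarrow> i \<le> n \<Longrightarrow> x i \<in> carrier G"
  by (auto simp: tuples_def PiE_iff)

lemma carrier_fixed_points:
  "x \<in> carrier (fixed_points G N) \<longleftrightarrow> x \<in> carrier N \<and> (\<forall>g\<in>carrier G. act N g x = x)"
  by (simp add: fixed_points_def)

lemma fixed_points_ops:
  "x \<otimes>\<^bsub>fixed_points G N\<^esub> y = x \<otimes>\<^bsub>N\<^esub> y" "\<one>\<^bsub>fixed_points G N\<^esub> = \<one>\<^bsub>N\<^esub>"
  by (simp_all add: fixed_points_def)

lemma carrier_cts_cochains:
  "f \<in> carrier (cts_cochains G M n) \<longleftrightarrow>
     f \<in> extensional (tuples G n) \<and> continuous_map (cube_top G (Suc n)) (mtop M) f"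
  by (simp add: cts_cochains_def lessThan_Suc_atMost)

lemma omit_in_tuples: "x \<in> tuples G (Suc n) \<Longrightarrow> omit n j x \<in> tuples G n"
  by (auto simp: tuples_def omit_def PiE_iff)

context compact_group
begin

lemma topspace_tuples: "topspace (cube_top G (Suc n)) = tuples G n"
  by (simp add: tuples_eq_cube)

lemma continuous_map_tuples:
  "continuous_map X (cube_top G (Suc n)) (\<lambda>x. \<lambda>i\<in>{..n}. f x i) \<longleftrightarrow>
     (\<forall>i\<le>n. continuous_map X (gtop G) (\<lambda>x. f x i))"
  by (auto simp: continuous_map_componentwise lessThan_Suc_atMost)

lemma continuous_map_coordinate: "i \<le> n \<Longrightarrow> continuous_map (cube_top G (Suc n)) (gtop G) (\<lambda>x. x i)"
  by (rule continuous_map_product_projection) simp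

lemma translate_in_tuples:
  "h \<in> carrier G \<Longrightarrow> x \<in> tuples G n \<Longrightarrow> (\<lambda>i\<in>{..n}. inv h \<otimes> x i) \<in> tuples G n"
  using tuples_component[of x G n] by (auto simp: tuples_def[of G n])

lemma prefix_prod_closed: "a \<in> tuples G n \<Longrightarrow> i \<le> n \<Longrightarrow> prefix_prod G a i \<in> carrier G"
  by (induction i) (auto simp: tuples_component)

lemma continuous_map_prefix_prod:
  "i \<le> n \<Longrightarrow> continuous_map (cube_top G (Suc n)) (gtop G) (\<lambda>a. prefix_prod G a i)"
  by (induction i) (auto intro!: continuous_map_mult continuous_map_coordinate)

lemma continuous_map_inv_prefixes:
  "continuous_map (cube_top G (Suc n)) (cube_top G (Suc n)) (inv_prefixes G n)"
  unfolding inv_prefixes_def continuous_map_tuples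
  by (intro allI impI continuous_map_inv continuous_map_prefix_prod)

lemma continuous_map_inv_steps:
  "continuous_map (cube_top G (Suc n)) (cube_top G (Suc n)) (inv_steps G n)"
proof -
  have "continuous_map (cube_top G (Suc n)) (gtop G)
          (\<lambda>x. case i of 0 \<Rightarrow> inv (x 0) | Suc j \<Rightarrow> inv (x i) \<otimes> x j)" if "i \<le> n" for i
    using that
    by (cases i) (auto intro!: continuous_map_mult continuous_map_inv continuous_map_coordinate)
  then show ?thesis
    unfolding inv_steps_def continuous_map_tuples by blast
qed

lemma continuous_map_omit:
  "continuous_map (cube_top G (Suc (Suc n))) (cube_top G (Suc n)) (omit n j)"
proof -
  have "continuous_map (cube_top G (Suc (Suc n))) (gtop G) (\<lambda>x. if i < j then x i else x (Suc i))"
    if "i \<le> n" for i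
    using that by (cases "i < j") (auto intro!: continuous_map_coordinate)
  then show ?thesis
    unfolding omit_def continuous_map_tuples by blast
qed

lemma inv_prefixes_in_tuples: "a \<in> tuples G n \<Longrightarrow> inv_prefixes G n a \<in> tuples G n"
  by (auto simp: tuples_def[of G n] inv_prefixes_def intro!: inv_closed prefix_prod_closed)

lemma inv_steps_in_tuples: "x \<in> tuples G n \<Longrightarrow> inv_steps G n x \<in> tuples G n"
  using tuples_component[of x G n] 
  by (auto simp: tuples_def[of G n] inv_steps_def split: nat.split)

lemma prefix_prod_inv_steps:
  assumes x: "x \<in> tuples G n" and "i \<le> n"
  shows "prefix_prod G (inv_steps G n x) i = inv (x i)"
  using \<open>i \<le> n\<close>
proof (induction i)
  case (Suc i)
  have "x i \<in> carrier G" "x (Suc i) \<in> carrier G" using Suc.prems by (auto intro: tuples_component[OF x])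
  then show ?case using Suc by (simp add: inv_steps_def m_assoc)
qed (simp add: inv_steps_def)

lemma inv_prefixes_inv_steps: "x \<in> tuples G n \<Longrightarrow> inv_prefixes G n (inv_steps G n x) = x"
  by (rule extensionalityI[of _ "{..n}"])
    (auto simp: inv_prefixes_def prefix_prod_inv_steps tuples_component, auto simp: tuples_def PiE_iff)

lemma inv_steps_inv_prefixes:
  assumes a: "a \<in> tuples G n"
  shows "inv_steps G n (inv_prefixes G n a) = a"
proof (rule extensionalityI[of _ "{..n}"])
  fix i assume i: "i \<in> {..n}"
  show "inv_steps G n (inv_prefixes G n a) i = a i"
  proof (cases i)
    case 0
    then show ?thesis using tuples_component[OF a, of 0] by (simp add: inv_steps_def inv_prefixes_def)
  next
    case (Suc j)
    then have "a i \<in> carrier G" "prefix_prod G a j \<in> carrier G"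
      using i by (auto intro: tuples_component[OF a] prefix_prod_closed[OF a])
    then show ?thesis using i Suc by (simp add: inv_steps_def inv_prefixes_def m_assoc)
  qed
qed (use a in \<open>auto simp: inv_steps_def tuples_def PiE_iff\<close>)

text \<open>
  Multiplying neighbours together omits one partial product and leaves the others alone.
\<close>

lemma prefix_prod_merge:
  assumes a: "a \<in> tuples G (Suc n)" and "j \<le> n" "i \<le> n"
  shows "prefix_prod G (merge G j a) i = prefix_prod G a (if i < j then i else Suc i)"
  using \<open>i \<le> n\<close>
proof (induction i)
  case 0
  then show ?case using assms by (auto simp: merge_def)
next
  case (Suc i)
  have "a (Suc i) \<in> carrier G" "a (Suc (Suc i)) \<in> carrier G" "prefix_prod G a i \<in> carrier G"
    using Suc.prems by (auto intro: tuples_component[OF a] prefix_prod_closed[OF a])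
  with Suc show ?case
    by (cases "Suc i = j") (auto simp: merge_def m_assoc)
qed

lemma prefix_prod_translate:
  assumes g: "g \<in> carrier G" and h: "h \<in> carrier G" and a: "case_nat g a \<in> tuples G n" and "i \<le> n"
  shows "prefix_prod G (case_nat (g \<otimes> h) a) i = prefix_prod G (case_nat g a) i \<otimes> h"
  using \<open>i \<le> n\<close>
proof (induction i)
  case (Suc i)
  have "a i \<in> carrier G" "prefix_prod G (case_nat g a) i \<in> carrier G"
    using tuples_component[OF a, of "Suc i"] prefix_prod_closed[OF a, of i] Suc.prems by auto
  with Suc h show ?case by (simp add: m_assoc)
qed simp

end

context compact_group_module
begin

lemma cochain_value: "f \<in> carrier (cts_cochains G M n) \<Longrightarrow> x \<in> tuples G n \<Longrightarrow> f x \<in> carrier M"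
  using topspace_tuples by (auto simp: carrier_cts_cochains continuous_map_def mtop Pi_iff)

lemma continuous_map_tuples_restrict:
  "continuous_map (cube_top G (Suc n)) Y (restrict f (tuples G n)) \<longleftrightarrow>
   continuous_map (cube_top G (Suc n)) Y f"
  by (rule continuous_map_restrict_topspace) (simp only: topspace_tuples)

lemma restrict_cochainI:
  "continuous_map (cube_top G (Suc n)) (mtop M) f \<Longrightarrow> restrict f (tuples G n) \<in> carrier (cts_cochains G M n)"
  by (simp only: carrier_cts_cochains continuous_map_tuples_restrict restrict_extensional simp_thms)

lemma comm_group_cts_cochains: "comm_group (cts_cochains G M n)" (is "comm_group ?C")
proof (rule comm_groupI)
  have m: "x \<otimes>\<^bsub>?C\<^esub> y = (\<lambda>a\<in>tuples G n. x a \<otimes>\<^bsub>M\<^esub> y a)" for x y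
    by (simp add: cts_cochains_def)
  have o: "\<one>\<^bsub>?C\<^esub> = (\<lambda>a\<in>tuples G n. \<one>\<^bsub>M\<^esub>)"
    by (simp add: cts_cochains_def)
  have ext: "x \<in> carrier ?C \<Longrightarrow> x \<in> extensional (tuples G n)" for x
    by (simp add: carrier_cts_cochains)
  show "x \<otimes>\<^bsub>?C\<^esub> y \<in> carrier ?C" if "x \<in> carrier ?C" "y \<in> carrier ?C" for x y
    unfolding m using that
    by (intro restrict_cochainI)
      (auto simp: carrier_cts_cochains mtop intro: continuous_map_discrete_combine)
  show "\<one>\<^bsub>?C\<^esub> \<in> carrier ?C"
    unfolding o by (intro restrict_cochainI) (simp add: mtop)
  show "x \<otimes>\<^bsub>?C\<^esub> y \<otimes>\<^bsub>?C\<^esub> z = x \<otimes>\<^bsub>?C\<^esub> (y \<otimes>\<^bsub>?C\<^esub> z)"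
    if "x \<in> carrier ?C" "y \<in> carrier ?C" "z \<in> carrier ?C" for x y z
    unfolding m using that by (intro restrict_ext) (simp add: cochain_value M.m_assoc)
  show "x \<otimes>\<^bsub>?C\<^esub> y = y \<otimes>\<^bsub>?C\<^esub> x" if "x \<in> carrier ?C" "y \<in> carrier ?C" for x y
    unfolding m using that by (intro restrict_ext) (simp add: cochain_value M.m_comm)
  show "\<one>\<^bsub>?C\<^esub> \<otimes>\<^bsub>?C\<^esub> x = x" if "x \<in> carrier ?C" for x
    unfolding m o
    by (rule extensionalityI[OF restrict_extensional ext[OF that]]) (simp add: cochain_value[OF that])
  show "\<exists>y\<in>carrier ?C. y \<otimes>\<^bsub>?C\<^esub> x = \<one>\<^bsub>?C\<^esub>" if x: "x \<in> carrier ?C" for x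
  proof
    have c: "continuous_map (cube_top G (Suc n)) (discrete_topology (carrier M)) x"
      using x by (simp add: carrier_cts_cochains mtop)
    show "(\<lambda>a\<in>tuples G n. inv\<^bsub>M\<^esub> x a) \<in> carrier ?C"
      by (intro restrict_cochainI, unfold mtop)
        (rule continuous_map_discrete_combine[OF c c, of "\<lambda>u v. inv\<^bsub>M\<^esub> u"], simp)
    show "(\<lambda>a\<in>tuples G n. inv\<^bsub>M\<^esub> x a) \<otimes>\<^bsub>?C\<^esub> x = \<one>\<^bsub>?C\<^esub>"
      unfolding m o by (intro restrict_ext) (simp add: cochain_value[OF x])
  qed
qed

lemma cochain_to_Gamma_closed:
  assumes "f \<in> carrier (cts_cochains G M n)"
  shows "cochain_to_Gamma G M n f \<in> carrier (Gamma_pow G M (Suc n))"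
  unfolding cochain_to_Gamma_def
proof (rule curry_iter_closed)
  have "continuous_map (cube_top G (Suc n)) (mtop M) (f \<circ> inv_prefixes G n)"
    using assms by (intro continuous_map_compose[OF continuous_map_inv_prefixes]) (simp add: carrier_cts_cochains)
  then show "continuous_map (cube_top G (Suc n)) (mtop M) (dehomogenize G M n f)"
    unfolding dehomogenize_def[abs_def] o_def
    by (intro continuous_map_act continuous_map_prefix_prod) auto
qed

text \<open>
  The value of \<open>dehomogenize G M n f\<close> at \<open>inv_steps G n x\<close> determines \<open>f x\<close>.  Below, this identifies a
  cochain with its translates and with its images under the structure maps of a tower, which are
  handled as mere functions on tuples.
\<close>

lemma cochain_to_Gamma_inject:
  assumes eq: "cochain_to_Gamma G M n f = cochain_to_Gamma G M n f'"
    and f: "f \<in> tuples G n \<rightarrow>\<^sub>E carrier M" and f': "f' \<in> tuples G n \<rightarrow>\<^sub>E carrier M"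
  shows "f = f'"
proof (rule PiE_ext[OF f f'])
  fix x assume x: "x \<in> tuples G n"
  have g: "x n \<in> carrier G" by (rule tuples_component[OF x order_refl])
  have fx: "f x \<in> carrier M" "f' x \<in> carrier M" using f f' x by auto
  have "inv_steps G n x \<in> cube G (Suc n)"
    using inv_steps_in_tuples[OF x] by (simp only: tuples_eq_cube)
  from curry_iter_inject[OF eq[unfolded cochain_to_Gamma_def] this]
  have "act M (inv (x n)) (f x) = act M (inv (x n)) (f' x)"
    by (simp add: dehomogenize_def inv_prefixes_inv_steps[OF x] prefix_prod_inv_steps[OF x])
  then have "act M (x n) (act M (inv (x n)) (f x)) = act M (x n) (act M (inv (x n)) (f' x))"
    by simp
  then show "f x = f' x"
    using g fx by (simp add: act_mult act_one)
qed

lemma cochain_to_Gamma_surj: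
  assumes "y \<in> carrier (Gamma_pow G M (Suc n))"
  shows "\<exists>f\<in>carrier (cts_cochains G M n). cochain_to_Gamma G M n f = y"
proof -
  from curry_iter_surj[OF assms] obtain c
    where c: "continuous_map (cube_top G (Suc n)) (mtop M) c" and y: "y = curry_iter G (Suc n) c"
    by blast
  \<comment> \<open>Solving \<open>c(a) = q\<^sub>n \<cdot> f(x)\<close> with \<open>x\<^sub>i = q\<^sub>i\<^sup>-\<^sup>1\<close> for \<open>f\<close>: the factor \<open>q\<^sub>n\<^sup>-\<^sup>1\<close> is the last coordinate of \<open>x\<close>.\<close>
  let ?f = "\<lambda>x\<in>tuples G n. act M (x n) (c (inv_steps G n x))"
  have "continuous_map (cube_top G (Suc n)) (mtop M) (c \<circ> inv_steps G n)"
    by (rule continuous_map_compose[OF continuous_map_inv_steps c])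
  then have "?f \<in> carrier (cts_cochains G M n)"
    unfolding o_def by (intro restrict_cochainI continuous_map_act continuous_map_coordinate order_refl)
  moreover have "cochain_to_Gamma G M n ?f = y"
    unfolding cochain_to_Gamma_def y
  proof (rule curry_iter_cong, fold tuples_eq_cube)
    fix a assume a: "a \<in> tuples G n"
    then have "c a \<in> carrier M"
      using c topspace_tuples by (auto simp: continuous_map_def mtop Pi_iff)
    moreover have "prefix_prod G a n \<in> carrier G"
      by (rule prefix_prod_closed[OF a order_refl])
    moreover have "inv_prefixes G n a n = inv (prefix_prod G a n)"
      by (simp add: inv_prefixes_def)
    ultimately show "dehomogenize G M n ?f a = c a"
      by (simp add: dehomogenize_def inv_prefixes_in_tuples[OF a] inv_steps_inv_prefixes[OF a]
          act_mult act_one)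
  qed
  ultimately show ?thesis by blast
qed

lemma cochain_to_Gamma_mult:
  assumes "f \<in> carrier (cts_cochains G M n)" "f' \<in> carrier (cts_cochains G M n)"
  shows "cochain_to_Gamma G M n (f \<otimes>\<^bsub>cts_cochains G M n\<^esub> f') =
         cochain_to_Gamma G M n f \<otimes>\<^bsub>Gamma_pow G M (Suc n)\<^esub> cochain_to_Gamma G M n f'"
  unfolding cochain_to_Gamma_def curry_iter_mult[symmetric]
proof (rule curry_iter_cong, fold tuples_eq_cube)
  fix a assume a: "a \<in> tuples G n"
  show "dehomogenize G M n (f \<otimes>\<^bsub>cts_cochains G M n\<^esub> f') a =
        dehomogenize G M n f a \<otimes>\<^bsub>M\<^esub> dehomogenize G M n f' a"
    using assms inv_prefixes_in_tuples[OF a] prefix_prod_closed[OF a order_refl]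
    by (simp add: dehomogenize_def cts_cochains_def[of G M n] hom_mult[OF act_hom]
        cochain_value[unfolded cts_cochains_def])
qed

lemma cochain_to_Gamma_one:
  "cochain_to_Gamma G M n \<one>\<^bsub>cts_cochains G M n\<^esub> = \<one>\<^bsub>Gamma_pow G M (Suc n)\<^esub>"
  unfolding cochain_to_Gamma_def curry_iter_one[symmetric]
proof (rule curry_iter_cong, fold tuples_eq_cube)
  fix a assume a: "a \<in> tuples G n"
  have "act M (prefix_prod G a n) \<one>\<^bsub>M\<^esub> = \<one>\<^bsub>M\<^esub>"
    by (rule hom_one[OF act_hom]) (use prefix_prod_closed[OF a order_refl] in auto)
  then show "dehomogenize G M n \<one>\<^bsub>cts_cochains G M n\<^esub> a = \<one>\<^bsub>M\<^esub>"
    by (simp add: dehomogenize_def cts_cochains_def inv_prefixes_in_tuples[OF a])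
qed

text \<open>
  The group axioms for \<open>\<Gamma>\<^sup>n\<^sup>+\<^sup>1 M\<close>, needed to compute with the products in its differential, are
  inherited from the cochain group, whose operations are pointwise.
\<close>

lemma comm_group_Gamma_pow: "comm_group (Gamma_pow G M (Suc n))"
proof (rule comm_group_surj_hom[OF comm_group_cts_cochains])
  show "cochain_to_Gamma G M n ` carrier (cts_cochains G M n) = carrier (Gamma_pow G M (Suc n))"
    using cochain_to_Gamma_closed cochain_to_Gamma_surj by blast
qed (simp_all only: cochain_to_Gamma_one cochain_to_Gamma_mult)

lemma cochain_to_Gamma_hom: "cochain_to_Gamma G M n \<in> hom (cts_cochains G M n) (Gamma_pow G M (Suc n))"
  by (rule homI) (simp_all only: cochain_to_Gamma_closed cochain_to_Gamma_mult)

text \<open>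
  Acting by \<open>h\<close> on \<open>\<Gamma>\<^sup>n\<^sup>+\<^sup>1 M\<close> replaces \<open>a\<^sub>0\<close> by \<open>a\<^sub>0 h\<close>, hence \<open>q\<^sub>i\<close> by \<open>q\<^sub>i h\<close> for all \<open>i\<close>; and
  \<open>(q\<^sub>n h) \<cdot> f((q\<^sub>i h)\<^sup>-\<^sup>1)\<close> is \<open>q\<^sub>n \<cdot> (h \<cdot> f)(q\<^sub>i\<^sup>-\<^sup>1)\<close>.
\<close>

lemma cochain_to_Gamma_act:
  assumes f: "f \<in> tuples G n \<rightarrow> carrier M" and h: "h \<in> carrier G"
  shows "cochain_to_Gamma G M n (act (cts_cochains G M n) h f) =
         act (Gamma_pow G M (Suc n)) h (cochain_to_Gamma G M n f)"
proof -
  have "curry_iter G n (\<lambda>a. dehomogenize G M n (act (cts_cochains G M n) h f) (case_nat g a)) =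
        curry_iter G n (\<lambda>a. dehomogenize G M n f (case_nat (g \<otimes> h) a))" if g: "g \<in> carrier G" for g
  proof (rule curry_iter_cong)
    fix a assume a: "a \<in> cube G n"
    let ?a = "case_nat g a" and ?b = "case_nat (g \<otimes> h) a"
    have at: "?a \<in> tuples G n" "?b \<in> tuples G n"
      unfolding tuples_eq_cube using g h a by (auto intro!: case_nat_in_cube)
    have "(\<lambda>i\<in>{..n}. inv h \<otimes> inv_prefixes G n ?a i) = inv_prefixes G n ?b"
      unfolding inv_prefixes_def
      using h prefix_prod_translate[OF g h at(1)] prefix_prod_closed[OF at(1)]
      by (intro restrict_ext) (simp add: inv_mult_group)
    moreover have "f (inv_prefixes G n ?b) \<in> carrier M"
      using f inv_prefixes_in_tuples[OF at(2)] by auto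
    ultimately show "dehomogenize G M n (act (cts_cochains G M n) h f) ?a = dehomogenize G M n f ?b"
      using h prefix_prod_closed[OF at(1) order_refl] inv_prefixes_in_tuples[OF at(1)]
      by (simp add: dehomogenize_def cts_cochains_def prefix_prod_translate[OF g h at(1)] act_mult)
  qed
  then show ?thesis
    using h by (simp add: cochain_to_Gamma_def Gamma_pow_Suc Gamma_def cong: restrict_cong)
qed

lemma cochain_to_Gamma_fixed_iff:
  assumes f: "f \<in> carrier (cts_cochains G M n)" and h: "h \<in> carrier G"
  shows "act (Gamma_pow G M (Suc n)) h (cochain_to_Gamma G M n f) = cochain_to_Gamma G M n f \<longleftrightarrow>
         act (cts_cochains G M n) h f = f"
proof -
  have fM: "f \<in> tuples G n \<rightarrow> carrier M" using cochain_value[OF f] by auto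
  have f1: "f \<in> tuples G n \<rightarrow>\<^sub>E carrier M"
    using fM f by (auto simp: carrier_cts_cochains PiE_iff)
  have f2: "act (cts_cochains G M n) h f \<in> tuples G n \<rightarrow>\<^sub>E carrier M"
    using h fM translate_in_tuples[OF h, of _ n] by (auto simp: cts_cochains_def intro!: act_closed)
  show ?thesis
    unfolding cochain_to_Gamma_act[OF fM h, symmetric]
    using cochain_to_Gamma_inject[OF _ f2 f1] by auto
qed

definition face :: "nat \<Rightarrow> nat \<Rightarrow> ((nat \<Rightarrow> 'g) \<Rightarrow> 'm) \<Rightarrow> (nat \<Rightarrow> 'g) \<Rightarrow> 'm" where
  "face n j f = (\<lambda>x\<in>tuples G (Suc n). f (omit n j x))"

lemma face_closed:
  assumes "f \<in> carrier (cts_cochains G M n)"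
  shows "face n j f \<in> carrier (cts_cochains G M (Suc n))"
proof -
  have "continuous_map (cube_top G (Suc (Suc n))) (mtop M) (f \<circ> omit n j)"
    using assms by (intro continuous_map_compose[OF continuous_map_omit]) (simp add: carrier_cts_cochains)
  then show ?thesis unfolding face_def o_def by (rule restrict_cochainI)
qed

text \<open>
  For \<open>j \<le> n\<close> the merged tuple has the partial products of \<open>a\<close> without \<open>q\<^sub>j\<close>.  For \<open>j = n + 1\<close> the
  truncated tuple has lost \<open>q\<^sub>n\<^sub>+\<^sub>1\<close>, and the outer action of \<open>a\<^sub>n\<^sub>+\<^sub>1\<close> turns the remaining factor \<open>q\<^sub>n\<close>
  back into \<open>q\<^sub>n\<^sub>+\<^sub>1\<close>.
\<close>

lemma cochain_to_Gamma_face: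
  assumes f: "f \<in> carrier (cts_cochains G M n)" and j: "j \<le> Suc n"
  shows "cochain_to_Gamma G M (Suc n) (face n j f) = coface G M n j (cochain_to_Gamma G M n f)"
proof -
  let ?c = "dehomogenize G M n f"
  have "coface G M n j (cochain_to_Gamma G M n f) = curry_iter G (Suc (Suc n))
      (\<lambda>a. if j < Suc n then ?c (merge G j a) else act M (a (Suc n)) (?c (restrict a {..<Suc n})))"
    unfolding coface_def cochain_to_Gamma_def Suc_eq_plus1[symmetric] by (rule coface_curry_iter[OF j])
  also have "\<dots> = cochain_to_Gamma G M (Suc n) (face n j f)"
    unfolding cochain_to_Gamma_def
  proof (rule curry_iter_cong, fold tuples_eq_cube)
    fix a assume a: "a \<in> tuples G (Suc n)"
    let ?x = "omit n j (inv_prefixes G (Suc n) a)"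
    have x: "?x \<in> tuples G n" by (intro omit_in_tuples inv_prefixes_in_tuples a)
    have L: "dehomogenize G M (Suc n) (face n j f) a = act M (prefix_prod G a (Suc n)) (f ?x)"
      unfolding dehomogenize_def face_def using inv_prefixes_in_tuples[OF a] by simp
    show "(if j < Suc n then ?c (merge G j a) else act M (a (Suc n)) (?c (restrict a {..<Suc n}))) =
      dehomogenize G M (Suc n) (face n j f) a"
    proof (cases "j < Suc n")
      case True
      then have "inv_prefixes G n (merge G j a) = ?x"
        unfolding inv_prefixes_def omit_def
        by (intro restrict_ext) (simp add: prefix_prod_merge[OF a])
      moreover have "prefix_prod G (merge G j a) n = prefix_prod G a (Suc n)"
        using True by (simp add: prefix_prod_merge[OF a] del: prefix_prod.simps)
      ultimately show ?thesis using True unfolding L by (simp add: dehomogenize_def)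
    next
      case False
      let ?b = "restrict a {..<Suc n}"
      have pb: "prefix_prod G ?b i = prefix_prod G a i" if "i \<le> n" for i
        using that by (induction i) auto
      have "inv_prefixes G n ?b = ?x"
        unfolding inv_prefixes_def omit_def
        using False j by (intro restrict_ext) (simp add: pb)
      moreover have "a (Suc n) \<in> carrier G" "prefix_prod G a n \<in> carrier G"
        by (auto intro: tuples_component[OF a] prefix_prod_closed[OF a])
      ultimately show ?thesis
        using False cochain_value[OF f x] unfolding L by (simp add: dehomogenize_def pb act_mult)
    qed
  qed
  finally show ?thesis by simp
qed

lemma eval_hom: "x \<in> tuples G n \<Longrightarrow> (\<lambda>f. f x) \<in> hom (cts_cochains G M n) M"
  by (rule homI) (simp_all add: cochain_value, simp add: cts_cochains_def)

text \<open>
  The differential is defined by pointwise products in \<open>M\<close>.  As a product in the cochain group it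
  can be pushed through the homomorphism \<open>cochain_to_Gamma\<close>.
\<close>

lemma cts_diff_eq_finprod:
  assumes f: "f \<in> carrier (cts_cochains G M n)"
  shows "cts_diff G M n f =
    finprod (cts_cochains G M (Suc n))
      (\<lambda>j. face n j f [^]\<^bsub>cts_cochains G M (Suc n)\<^esub> ((-1 :: int) ^ j)) {..Suc n}" (is "_ = ?P")
proof -
  let ?C = "cts_cochains G M (Suc n)"
  interpret C: comm_group ?C by (rule comm_group_cts_cochains)
  have "?P \<in> carrier ?C" by (intro C.finprod_closed) (auto intro: face_closed[OF f])
  then have "?P \<in> extensional (tuples G (Suc n))" by (simp add: carrier_cts_cochains)
  then show ?thesis
  proof (rule extensionalityI[rotated])
    show "cts_diff G M n f \<in> extensional (tuples G (Suc n))" by (simp add: cts_diff_def)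
    fix x assume x: "x \<in> tuples G (Suc n)"
    show "cts_diff G M n f x = ?P x"
      using hom_signed_finprod[OF comm_group_cts_cochains M.comm_group_axioms eval_hom[OF x],
          of "\<lambda>j. face n j f" "{..Suc n}" "\<lambda>j. (-1) ^ j"] face_closed[OF f] x
      by (simp add: cts_diff_def face_def)
  qed
qed

lemma cts_diff_closed:
  assumes f: "f \<in> carrier (cts_cochains G M n)"
  shows "cts_diff G M n f \<in> carrier (cts_cochains G M (Suc n))"
proof -
  interpret C: comm_group "cts_cochains G M (Suc n)" by (rule comm_group_cts_cochains)
  show ?thesis
    unfolding cts_diff_eq_finprod[OF f] by (intro C.finprod_closed) (auto intro: face_closed[OF f])
qed

lemma cochain_to_Gamma_diff:
  assumes f: "f \<in> carrier (cts_cochains G M n)"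
  shows "cochain_to_Gamma G M (Suc n) (cts_diff G M n f) = Gamma_diff G M n (cochain_to_Gamma G M n f)"
proof -
  let ?N = "Gamma_pow G M (Suc (Suc n))"
  interpret N: comm_group ?N by (rule comm_group_Gamma_pow)
  have cl: "cochain_to_Gamma G M (Suc n) (face n j f) \<in> carrier ?N" for j
    by (intro cochain_to_Gamma_closed face_closed f)
  have "cochain_to_Gamma G M (Suc n) (cts_diff G M n f) =
     finprod ?N (\<lambda>j. cochain_to_Gamma G M (Suc n) (face n j f) [^]\<^bsub>?N\<^esub> ((-1 :: int) ^ j)) {..Suc n}"
    unfolding cts_diff_eq_finprod[OF f]
    by (rule hom_signed_finprod[OF comm_group_cts_cochains comm_group_Gamma_pow cochain_to_Gamma_hom])
      (auto intro: face_closed[OF f])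
  also have "\<dots> = finprod ?N (\<lambda>j. coface G M n j (cochain_to_Gamma G M n f) [^]\<^bsub>?N\<^esub> ((-1 :: int) ^ j)) {..Suc n}"
    using cl by (intro N.finprod_cong') (auto simp: cochain_to_Gamma_face[OF f, symmetric])
  also have "\<dots> = Gamma_diff G M n (cochain_to_Gamma G M n f)"
    by (simp add: Gamma_diff_def)
  finally show ?thesis .
qed

lemma cts_diff_fixed:
  assumes f: "f \<in> carrier (cts_cochains G M n)" and h: "h \<in> carrier G"
    and fix_f: "act (cts_cochains G M n) h f = f"
  shows "act (cts_cochains G M (Suc n)) h (cts_diff G M n f) = cts_diff G M n f"
proof -
  have "act M h (cts_diff G M n f (\<lambda>i\<in>{..Suc n}. inv h \<otimes> x i)) = cts_diff G M n f x"
    if x: "x \<in> tuples G (Suc n)" for x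
  proof -
    let ?y = "\<lambda>i\<in>{..Suc n}. inv h \<otimes> x i"
    have y: "?y \<in> tuples G (Suc n)" by (rule translate_in_tuples[OF h x])
    have omit: "omit n j ?y = (\<lambda>i\<in>{..n}. inv h \<otimes> omit n j x i)" for j
      unfolding omit_def by (intro restrict_ext) auto
    have "act M h (f (omit n j ?y)) = act (cts_cochains G M n) h f (omit n j x)" for j
      unfolding omit by (simp add: cts_cochains_def omit_in_tuples[OF x])
    then have *: "act M h (f (omit n j ?y)) = f (omit n j x)" for j by (simp add: fix_f)
    have "act M h (finprod M (\<lambda>j. f (omit n j ?y) [^]\<^bsub>M\<^esub> ((-1 :: int) ^ j)) {..Suc n}) =
      finprod M (\<lambda>j. act M h (f (omit n j ?y)) [^]\<^bsub>M\<^esub> ((-1 :: int) ^ j)) {..Suc n}"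
      by (rule hom_signed_finprod[OF M.comm_group_axioms M.comm_group_axioms act_hom[OF h]])
        (auto intro!: cochain_value[OF f] omit_in_tuples y)
    then show ?thesis
      unfolding * cts_diff_def using x y by simp
  qed
  then show ?thesis
    by (simp add: cts_cochains_def cts_diff_def cong: restrict_cong)
qed

end

lemma cochain_to_Gamma_natural:
  assumes M: "compact_group_module G M" and N: "compact_group_module G N"
    and \<phi>: "\<phi> \<in> gmod_hom G M N" and f: "f \<in> carrier (cts_cochains G M n)"
    and f': "\<And>x. x \<in> tuples G n \<Longrightarrow> f' x = \<phi> (f x)"
  shows "(Gamma_map G ^^ Suc n) (lift_map \<phi>) (cochain_to_Gamma G M n f) = cochain_to_Gamma G N n f'"
  unfolding cochain_to_Gamma_def curry_iter_natural
proof (rule curry_iter_cong, fold tuples_eq_cube)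
  interpret M: compact_group_module G M by fact
  fix a assume a: "a \<in> tuples G n"
  note x = M.inv_prefixes_in_tuples[OF a]
  show "\<phi> (dehomogenize G M n f a) = dehomogenize G N n f' a"
    using \<phi> M.cochain_value[OF f x] M.prefix_prod_closed[OF a order_refl] f'[OF x]
    by (simp add: dehomogenize_def gmod_hom_def)
qed

section \<open>Passage to the limit\<close>

locale module_tower = compact_group G for G :: "'g topgroup" (structure) +
  fixes M :: "nat \<Rightarrow> ('g, 'm) top_gmod" and \<phi> :: "nat \<Rightarrow> 'm \<Rightarrow> 'm"
  assumes discrete: "\<And>i. discrete_module G (M i)"
    and tower: "\<And>i. \<phi> i \<in> gmod_hom G (M (Suc i)) (M i)"
begin

sublocale M: compact_group_module G "M i" for i
  by unfold_locales (rule discrete)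

abbreviation L :: "('g, nat \<Rightarrow> 'm) top_gmod" where "L \<equiv> lim_module M \<phi>"

lemma carrier_L: "x \<in> carrier L \<longleftrightarrow> (\<forall>i. x i \<in> carrier (M i)) \<and> (\<forall>i. \<phi> i (x (Suc i)) = x i)"
  by (auto simp: lim_module_def lim_group_def PiE_iff)

lemma mult_L: "x \<otimes>\<^bsub>L\<^esub> y = (\<lambda>i. x i \<otimes>\<^bsub>M i\<^esub> y i)"
  by (simp add: lim_module_def lim_group_def restrict_def)

lemma one_L: "\<one>\<^bsub>L\<^esub> = (\<lambda>i. \<one>\<^bsub>M i\<^esub>)"
  by (simp add: lim_module_def lim_group_def restrict_def)

lemma act_L: "act L g x = (\<lambda>i. act (M i) g (x i))"
  by (simp add: lim_module_def)

lemma tower_hom: "\<phi> i \<in> hom (M (Suc i)) (M i)"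
  using tower by (simp add: gmod_hom_def)

lemma tower_closed: "x \<in> carrier (M (Suc i)) \<Longrightarrow> \<phi> i x \<in> carrier (M i)"
  using tower_hom by (auto simp: hom_def)

lemma tower_one: "\<phi> i \<one>\<^bsub>M (Suc i)\<^esub> = \<one>\<^bsub>M i\<^esub>"
  by (rule hom_one[OF tower_hom]) (rule M.M.group_axioms)+

lemma comm_group_L: "comm_group L"
proof (rule comm_groupI)
  fix x assume x: "x \<in> carrier L"
  interpret \<phi>: group_hom "M (Suc i)" "M i" "\<phi> i" for i
    by unfold_locales (rule tower_hom)
  show "\<exists>y\<in>carrier L. y \<otimes>\<^bsub>L\<^esub> x = \<one>\<^bsub>L\<^esub>"
    using x by (intro bexI[of _ "\<lambda>i. inv\<^bsub>M i\<^esub> x i"]) (auto simp: carrier_L mult_L one_L)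
qed (auto simp: carrier_L mult_L one_L tower_one hom_mult[OF tower_hom] M.M.m_assoc M.M.m_comm M.M.m_lcomm)

lemma projection_hom: "(\<lambda>x. x i) \<in> hom L (M i)"
  by (rule homI) (auto simp: carrier_L mult_L)

definition component :: "nat \<Rightarrow> ((nat \<Rightarrow> 'g) \<Rightarrow> nat \<Rightarrow> 'm) \<Rightarrow> nat \<Rightarrow> (nat \<Rightarrow> 'g) \<Rightarrow> 'm" where
  "component n f i = (\<lambda>x\<in>tuples G n. f x i)"

text \<open>
  Continuity into the limit is continuity of all components.  This reduces every statement about
  cochains with values in the limit to the discrete modules of the tower.
\<close>

lemma cts_cochains_L_iff:
  "f \<in> carrier (cts_cochains G L n) \<longleftrightarrow>
     f \<in> extensional (tuples G n) \<and> (\<forall>i. component n f i \<in> carrier (cts_cochains G (M i) n)) \<and>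
     (\<forall>x\<in>tuples G n. \<forall>i. \<phi> i (f x (Suc i)) = f x i)" (is "?A \<longleftrightarrow> _ \<and> ?B \<and> ?C")
proof -
  let ?X = "cube_top G (Suc n)"
  have cont: "component n f i \<in> carrier (cts_cochains G (M i) n) \<longleftrightarrow>
      continuous_map ?X (mtop (M i)) (\<lambda>x. f x i)" for i
    unfolding component_def carrier_cts_cochains M.continuous_map_tuples_restrict by simp
  have "continuous_map ?X (mtop L) f \<longleftrightarrow>
      (\<forall>i. continuous_map ?X (mtop (M i)) (\<lambda>x. f x i)) \<and> (\<forall>x\<in>tuples G n. f x \<in> carrier L)"
    using topspace_tuples[of n]
    by (simp add: lim_module_def continuous_map_in_subtopology continuous_map_componentwise_UNIV
        image_subset_iff Pi_iff)
  also have "\<dots> \<longleftrightarrow> ?B \<and> ?C"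
    unfolding cont carrier_L
    using topspace_tuples[of n] by (auto simp: M.mtop continuous_map_def Pi_iff)
  finally show ?thesis unfolding carrier_cts_cochains by blast
qed

lemma cochain_L_value:
  assumes f: "f \<in> carrier (cts_cochains G L n)" and x: "x \<in> tuples G n"
  shows "f x \<in> carrier L"
proof -
  have "component n f i x \<in> carrier (M i)" for i
    using f x by (intro M.cochain_value) (simp_all add: cts_cochains_L_iff)
  then show ?thesis using f x by (simp add: cts_cochains_L_iff carrier_L component_def)
qed

lemma component_mult:
  "component n (f \<otimes>\<^bsub>cts_cochains G L n\<^esub> f') i =
   component n f i \<otimes>\<^bsub>cts_cochains G (M i) n\<^esub> component n f' i"
  by (auto simp: component_def cts_cochains_def mult_L fun_eq_iff)

lemma component_one: "component n \<one>\<^bsub>cts_cochains G L n\<^esub> i = \<one>\<^bsub>cts_cochains G (M i) n\<^esub>"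
  by (auto simp: component_def cts_cochains_def one_L fun_eq_iff)

lemma component_act:
  "h \<in> carrier G \<Longrightarrow>
   component n (act (cts_cochains G L n) h f) i = act (cts_cochains G (M i) n) h (component n f i)"
  by (auto simp: component_def cts_cochains_def act_L translate_in_tuples fun_eq_iff)

lemma component_diff:
  assumes f: "f \<in> carrier (cts_cochains G L n)"
  shows "component (Suc n) (cts_diff G L n f) i = cts_diff G (M i) n (component n f i)"
  unfolding component_def[of "Suc n"] cts_diff_def[of G "M i"]
proof (rule restrict_ext)
  fix x assume x: "x \<in> tuples G (Suc n)"
  have "cts_diff G L n f x i =
      finprod (M i) (\<lambda>j. f (omit n j x) i [^]\<^bsub>M i\<^esub> ((-1 :: int) ^ j)) {..Suc n}"
    unfolding cts_diff_def restrict_apply'[OF x]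
    by (rule hom_signed_finprod[OF comm_group_L M.M.comm_group_axioms projection_hom])
      (auto intro!: cochain_L_value[OF f] omit_in_tuples x)
  then show "cts_diff G L n f x i = finprod (M i)
      (\<lambda>j. component n f i (omit n j x) [^]\<^bsub>M i\<^esub> ((-1 :: int) ^ j)) {..Suc n}"
    by (simp add: component_def omit_in_tuples[OF x])
qed

lemma component_inject:
  assumes "f \<in> extensional (tuples G n)" "f' \<in> extensional (tuples G n)"
    and eq: "\<And>i. component n f i = component n f' i"
  shows "f = f'"
proof (rule extensionalityI[OF assms(1,2)], rule ext)
  fix x i assume "x \<in> tuples G n"
  then show "f x i = f' x i" using fun_cong[OF eq[of i], of x] by (simp add: component_def)
qed

lemma carrier_fixed_L_iff:
  "f \<in> carrier (fixed_points G (cts_cochains G L n)) \<longleftrightarrow>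
     f \<in> extensional (tuples G n) \<and>
     (\<forall>i. component n f i \<in> carrier (fixed_points G (cts_cochains G (M i) n))) \<and>
     (\<forall>x\<in>tuples G n. \<forall>i. \<phi> i (f x (Suc i)) = f x i)"
proof -
  have "act (cts_cochains G L n) h f = f \<longleftrightarrow>
      (\<forall>i. act (cts_cochains G (M i) n) h (component n f i) = component n f i)"
    if f: "f \<in> extensional (tuples G n)" and h: "h \<in> carrier G" for h
  proof -
    have "act (cts_cochains G L n) h f \<in> extensional (tuples G n)" by (simp add: cts_cochains_def)
    from component_inject[OF this f] show ?thesis
      unfolding component_act[OF h, symmetric] by auto
  qed
  then show ?thesis
    by (auto simp: fixed_points_def cts_cochains_L_iff)
qed

lemma component_closed:
  "f \<in> carrier (fixed_points G (cts_cochains G L n)) \<Longrightarrow>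
   component n f i \<in> carrier (cts_cochains G (M i) n)"
  by (simp add: fixed_points_def cts_cochains_L_iff)

definition comparison :: "nat \<Rightarrow> ((nat \<Rightarrow> 'g) \<Rightarrow> nat \<Rightarrow> 'm) \<Rightarrow> nat \<Rightarrow> ('g, 'm) iter" where
  "comparison n f = (\<lambda>i. cochain_to_Gamma G (M i) n (component n f i))"

lemma carrier_prodiscrete_iff:
  "y \<in> carrier (prodiscrete_complex G M \<phi> n) \<longleftrightarrow>
     (\<forall>i. y i \<in> carrier (fixed_points G (Gamma_pow G (M i) (Suc n)))) \<and>
     (\<forall>i. (Gamma_map G ^^ Suc n) (lift_map (\<phi> i)) (y (Suc i)) = y i)"
  by (auto simp: prodiscrete_complex_def lim_group_def PiE_iff)

text \<open>
  Naturality together with injectivity: compatibility in the tower of the \<open>\<Gamma>\<^sup>n\<^sup>+\<^sup>1 M\<^sub>i\<close> amounts to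
  compatibility of the cochains themselves, so that preimages of a compatible family assemble to a
  cochain with values in the limit.
\<close>

lemma tower_compatible_iff:
  assumes f: "f \<in> carrier (cts_cochains G (M (Suc i)) n)" and f': "f' \<in> carrier (cts_cochains G (M i) n)"
  shows "(Gamma_map G ^^ Suc n) (lift_map (\<phi> i)) (cochain_to_Gamma G (M (Suc i)) n f) =
           cochain_to_Gamma G (M i) n f' \<longleftrightarrow> (\<forall>x\<in>tuples G n. \<phi> i (f x) = f' x)"
proof -
  let ?g = "\<lambda>x\<in>tuples G n. \<phi> i (f x)"
  have nat: "(Gamma_map G ^^ Suc n) (lift_map (\<phi> i)) (cochain_to_Gamma G (M (Suc i)) n f) =
      cochain_to_Gamma G (M i) n ?g"
    by (rule cochain_to_Gamma_natural[OF M.compact_group_module_axioms M.compact_group_module_axioms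
          tower f]) simp
  have g: "?g \<in> tuples G n \<rightarrow>\<^sub>E carrier (M i)"
    using M.cochain_value[OF f] by (auto intro!: tower_closed)
  have "f' \<in> tuples G n \<rightarrow>\<^sub>E carrier (M i)"
    using M.cochain_value[OF f'] f' by (auto simp: carrier_cts_cochains PiE_iff)
  then have "cochain_to_Gamma G (M i) n ?g = cochain_to_Gamma G (M i) n f' \<longleftrightarrow> ?g = f'"
    using M.cochain_to_Gamma_inject[OF _ g] by blast
  moreover have "?g = f' \<longleftrightarrow> (\<forall>x\<in>tuples G n. \<phi> i (f x) = f' x)"
    using f' by (auto simp: carrier_cts_cochains extensional_def fun_eq_iff)
  ultimately show ?thesis unfolding nat by simp
qed

lemma fixed_Gamma_iff:
  "f \<in> carrier (cts_cochains G (M i) n) \<Longrightarrow>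
   cochain_to_Gamma G (M i) n f \<in> carrier (fixed_points G (Gamma_pow G (M i) (Suc n))) \<longleftrightarrow>
   f \<in> carrier (fixed_points G (cts_cochains G (M i) n))"
  by (simp add: fixed_points_def M.cochain_to_Gamma_closed M.cochain_to_Gamma_fixed_iff)

lemma comparison_bij:
  "bij_betw (comparison n) (carrier (fixed_points G (cts_cochains G L n)))
     (carrier (prodiscrete_complex G M \<phi> n))"
  unfolding bij_betw_def
proof (intro conjI subset_antisym subsetI)
  show "inj_on (comparison n) (carrier (fixed_points G (cts_cochains G L n)))"
  proof (rule inj_onI)
    fix f f' assume f: "f \<in> carrier (fixed_points G (cts_cochains G L n))"
      and f': "f' \<in> carrier (fixed_points G (cts_cochains G L n))"
      and eq: "comparison n f = comparison n f'"
    have PiE: "g \<in> carrier (cts_cochains G (M i) n) \<Longrightarrow> g \<in> tuples G n \<rightarrow>\<^sub>E carrier (M i)" for g i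
      using M.cochain_value[of g i n] by (auto simp: carrier_cts_cochains PiE_iff)
    show "f = f'"
    proof (rule component_inject)
      fix i
      show "component n f i = component n f' i"
        by (rule M.cochain_to_Gamma_inject[OF _ PiE PiE])
          (use fun_cong[OF eq, of i] component_closed[OF f] component_closed[OF f'] in \<open>simp_all add: comparison_def\<close>)
    qed (use f f' in \<open>auto simp: carrier_fixed_L_iff\<close>)
  qed
  show "y \<in> carrier (prodiscrete_complex G M \<phi> n)"
    if "y \<in> comparison n ` carrier (fixed_points G (cts_cochains G L n))" for y
  proof -
    from that obtain f where f: "f \<in> carrier (fixed_points G (cts_cochains G L n))"
      and y: "y = comparison n f" by blast
    show ?thesis
      using f unfolding carrier_prodiscrete_iff y comparison_def
        tower_compatible_iff[OF component_closed[OF f] component_closed[OF f]] fixed_Gamma_iff[OF component_closed[OF f]]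
      by (simp add: carrier_fixed_L_iff component_def)
  qed
  show "y \<in> comparison n ` carrier (fixed_points G (cts_cochains G L n))"
    if y: "y \<in> carrier (prodiscrete_complex G M \<phi> n)" for y
  proof -
    have "\<exists>f. f \<in> carrier (cts_cochains G (M i) n) \<and> cochain_to_Gamma G (M i) n f = y i" for i
      using y M.cochain_to_Gamma_surj[of "y i" i n]
      by (auto simp: carrier_prodiscrete_iff fixed_points_def)
    then obtain u where u: "\<And>i. u i \<in> carrier (cts_cochains G (M i) n)"
      and Tu: "\<And>i. cochain_to_Gamma G (M i) n (u i) = y i" by metis
    let ?f = "\<lambda>x\<in>tuples G n. \<lambda>i. u i x"
    have comp: "component n ?f i = u i" for i
      using u[of i] by (auto simp: component_def carrier_cts_cochains extensional_def fun_eq_iff)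
    have "u i \<in> carrier (fixed_points G (cts_cochains G (M i) n))" for i
      using y fixed_Gamma_iff[OF u[of i]] unfolding Tu carrier_prodiscrete_iff by blast
    moreover have "\<phi> i (u (Suc i) x) = u i x" if "x \<in> tuples G n" for x i
      using y that tower_compatible_iff[OF u u, of i] unfolding Tu carrier_prodiscrete_iff by blast
    ultimately have "?f \<in> carrier (fixed_points G (cts_cochains G L n))"
      unfolding carrier_fixed_L_iff comp by simp
    moreover have "comparison n ?f = y"
      unfolding comparison_def comp Tu ..
    ultimately show ?thesis by blast
  qed
qed

lemma fixed_cochains_closed:
  assumes f: "f \<in> carrier (fixed_points G (cts_cochains G (M i) n))"
    and f': "f' \<in> carrier (fixed_points G (cts_cochains G (M i) n))"
  shows "f \<otimes>\<^bsub>cts_cochains G (M i) n\<^esub> f' \<in> carrier (fixed_points G (cts_cochains G (M i) n))"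
proof -
  interpret C: comm_group "cts_cochains G (M i) n" by (rule M.comm_group_cts_cochains)
  from f f' have ff: "f \<in> carrier (cts_cochains G (M i) n)" "f' \<in> carrier (cts_cochains G (M i) n)"
    by (auto simp: carrier_fixed_points)
  have "act (cts_cochains G (M i) n) h (f \<otimes>\<^bsub>cts_cochains G (M i) n\<^esub> f') =
      act (cts_cochains G (M i) n) h f \<otimes>\<^bsub>cts_cochains G (M i) n\<^esub> act (cts_cochains G (M i) n) h f'"
    if h: "h \<in> carrier G" for h
    using M.cochain_value[OF ff(1)] M.cochain_value[OF ff(2)] translate_in_tuples[OF h, of _ n] h
    by (auto simp: cts_cochains_def hom_mult[OF M.act_hom] fun_eq_iff)
  then show ?thesis
    using f f' by (simp add: carrier_fixed_points)
qed

lemma fixed_L_mult_closed: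
  assumes f: "f \<in> carrier (fixed_points G (cts_cochains G L n))"
    and f': "f' \<in> carrier (fixed_points G (cts_cochains G L n))"
  shows "f \<otimes>\<^bsub>cts_cochains G L n\<^esub> f' \<in> carrier (fixed_points G (cts_cochains G L n))"
  unfolding carrier_fixed_L_iff component_mult
proof (intro conjI allI ballI)
  show "f \<otimes>\<^bsub>cts_cochains G L n\<^esub> f' \<in> extensional (tuples G n)" by (simp add: cts_cochains_def)
  show "component n f i \<otimes>\<^bsub>cts_cochains G (M i) n\<^esub> component n f' i
      \<in> carrier (fixed_points G (cts_cochains G (M i) n))" for i
    using f f' by (intro fixed_cochains_closed) (auto simp: carrier_fixed_L_iff)
  fix x i assume x: "x \<in> tuples G n"
  have "f x \<in> carrier L" "f' x \<in> carrier L"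
    using f f' x by (auto intro: cochain_L_value simp: carrier_fixed_points)
  then show "\<phi> i ((f \<otimes>\<^bsub>cts_cochains G L n\<^esub> f') x (Suc i)) = (f \<otimes>\<^bsub>cts_cochains G L n\<^esub> f') x i"
    using x by (simp add: cts_cochains_def mult_L carrier_L hom_mult[OF tower_hom])
qed

lemma fixed_L_one_closed: "\<one>\<^bsub>cts_cochains G L n\<^esub> \<in> carrier (fixed_points G (cts_cochains G L n))"
  unfolding carrier_fixed_L_iff component_one
proof (intro conjI allI ballI)
  show "\<one>\<^bsub>cts_cochains G L n\<^esub> \<in> extensional (tuples G n)" by (simp add: cts_cochains_def)
  fix i
  interpret C: comm_group "cts_cochains G (M i) n" by (rule M.comm_group_cts_cochains)
  have "act (M i) h \<one>\<^bsub>M i\<^esub> = \<one>\<^bsub>M i\<^esub>" if "h \<in> carrier G" for h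
    by (rule hom_one[OF M.act_hom[OF that]]) (rule M.M.group_axioms)+
  then have "act (cts_cochains G (M i) n) h \<one>\<^bsub>cts_cochains G (M i) n\<^esub> = \<one>\<^bsub>cts_cochains G (M i) n\<^esub>"
    if "h \<in> carrier G" for h
    using that by (auto simp: cts_cochains_def translate_in_tuples fun_eq_iff)
  then show "\<one>\<^bsub>cts_cochains G (M i) n\<^esub> \<in> carrier (fixed_points G (cts_cochains G (M i) n))"
    by (simp add: carrier_fixed_points)
  fix x assume "x \<in> tuples G n"
  then show "\<phi> i (\<one>\<^bsub>cts_cochains G L n\<^esub> x (Suc i)) = \<one>\<^bsub>cts_cochains G L n\<^esub> x i"
    by (simp add: cts_cochains_def one_L tower_one)
qed

lemma fixed_L_diff_closed:
  assumes f: "f \<in> carrier (fixed_points G (cts_cochains G L n))"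
  shows "cts_diff G L n f \<in> carrier (fixed_points G (cts_cochains G L (Suc n)))"
proof -
  interpret L: comm_group L by (rule comm_group_L)
  have fL: "f \<in> carrier (cts_cochains G L n)" using f by (simp add: carrier_fixed_points)
  have comp: "component n f i \<in> carrier (fixed_points G (cts_cochains G (M i) n))" for i
    using f by (simp add: carrier_fixed_L_iff)
  show ?thesis
    unfolding carrier_fixed_L_iff component_diff[OF fL]
  proof (intro conjI allI ballI)
    show "cts_diff G L n f \<in> extensional (tuples G (Suc n))" by (simp add: cts_diff_def)
    show "cts_diff G (M i) n (component n f i)
        \<in> carrier (fixed_points G (cts_cochains G (M i) (Suc n)))" for i
      using comp[of i] by (auto simp: carrier_fixed_points intro: M.cts_diff_closed M.cts_diff_fixed)
    fix x i assume x: "x \<in> tuples G (Suc n)"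
    have "cts_diff G L n f x \<in> carrier L"
      unfolding cts_diff_def restrict_apply'[OF x]
      by (intro L.finprod_closed) (auto intro!: cochain_L_value[OF fL] omit_in_tuples x)
    then show "\<phi> i (cts_diff G L n f x (Suc i)) = cts_diff G L n f x i"
      by (simp add: carrier_L)
  qed
qed

lemma cts_cohomology_iso_prodiscrete:
  "cts_cohomology G L s \<cong> cochain_cohomology (prodiscrete_complex G M \<phi>) (prodiscrete_diff G M) s"
  unfolding cts_cohomology_def
proof (rule cochain_cohomology_iso[of comparison])
  fix n
  show "comparison n \<one>\<^bsub>fixed_points G (cts_cochains G L n)\<^esub> = \<one>\<^bsub>prodiscrete_complex G M \<phi> n\<^esub>"
    unfolding comparison_def fixed_points_ops component_one M.cochain_to_Gamma_one
    by (simp add: prodiscrete_complex_def lim_group_def fixed_points_ops restrict_def)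
  fix f assume f: "f \<in> carrier (fixed_points G (cts_cochains G L n))"
  have fL: "f \<in> carrier (cts_cochains G L n)" using f by (simp add: carrier_fixed_points)
  show "comparison (Suc n) (cts_diff G L n f) = prodiscrete_diff G M n (comparison n f)"
    unfolding comparison_def prodiscrete_diff_def component_diff[OF fL]
      M.cochain_to_Gamma_diff[OF component_closed[OF f]] ..
  fix f' assume f': "f' \<in> carrier (fixed_points G (cts_cochains G L n))"
  show "comparison n (f \<otimes>\<^bsub>fixed_points G (cts_cochains G L n)\<^esub> f') =
      comparison n f \<otimes>\<^bsub>prodiscrete_complex G M \<phi> n\<^esub> comparison n f'"
    unfolding comparison_def fixed_points_ops component_mult M.cochain_to_Gamma_mult[OF component_closed[OF f] component_closed[OF f']]
    by (simp add: prodiscrete_complex_def lim_group_def fixed_points_ops restrict_def)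
qed (auto simp: comparison_bij fixed_points_ops fixed_L_one_closed
      intro: fixed_L_mult_closed fixed_L_diff_closed)

end

theorem theorem2p3:
  fixes G :: "'g topgroup"
    and M :: "nat \<Rightarrow> ('g, 'm) top_gmod"
    and \<phi> :: "nat \<Rightarrow> 'm \<Rightarrow> 'm"
    and s :: nat
  assumes "profinite_group G"
    and "finite_vcd TYPE(('g, 'm) module_universe) G"
    and "\<And>i. discrete_module G (M i)"
    and "\<And>i. \<phi> i \<in> gmod_hom G (M (Suc i)) (M i)"
  shows "cts_cohomology G (lim_module M \<phi>) s \<cong>
         cochain_cohomology (prodiscrete_complex G M \<phi>) (prodiscrete_diff G M) s"
proof -
  interpret module_tower G M \<phi>
    using assms(1,3,4) by unfold_locales (auto simp: profinite_group_def)
  show ?thesis by (rule cts_cohomology_iso_prodiscrete)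
qed

end
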